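(* Let $\mathcal{H}$ be a real or complex Hilbert space with $\dim\mathcal{H}=n\in\mathbb{N}$, let $\mathcal{F}=\{f_i\}_{i=1}^p\subseteq\mathcal{H}$ be a finite sequence with frame operator $S^{\mathcal{F}}$, let $\lambda_1\ge\dots\ge\lambda_n$ be the eigenvalues of $S^{\mathcal{F}}$ counted with multiplicity, let $\alpha=\operatorname{tr}(S^{\mathcal{F}})$, and let $\mathbf{a}=\{a_i\}_{i\in\mathbb{N}}$ be a non-increasing sequence of positive real numbers. Define $c_0=\lambda_1$ and, for $1\le k\le n$, $c_k=\max\left(c_{k-1},\ \frac1k\sum_{i=1}^k(a_i+\lambda_{n-i+1})\right)$. Assume that $\mathcal{F}$ is $(\mathbf{a},r)$-completable for some $r\in\mathbb{N}\cup\{\infty\}$ and let $r_0\in\mathbb{N}\cup\{\infty\}$ be the minimum such that $\mathcal{F}$ is $(\mathbf{a},r_0)$-completable. Then: Case 1: $r_0<n$ if and only if $c_{r_0}=\frac1n\left(\sum_{i=1}^{r_0} a_i+\alpha\right)$. Case 2: $n\le r_0<\infty$ if and only if $c_k\ne\frac1n\left(\sum_{i=1}^k a_i+\alpha\right)$ for all $1\le k\le n-1$ and $r_0$ is the minimum such that $c_n\le\frac1n\left(\sum_{i=1}^{r_0} a_i+\alpha\right)$. Case 3: $r_0=\infty$ if and only if $c_k\ne\frac1n\left(\sum_{i=1}^k a_i+\alpha\right)$ for all $1\le k\le n-1$ and $c_n=\frac1n\left(\sum_{i=1}^\infty a_i+\alpha\right)$.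
   Context: $\mathbb{N}=\{1,2,\dots\}$. For $m\in\mathbb{N}\cup\{\infty\}$, a sequence $\{f_i\}_{i=1}^m\subset\mathcal{H}$ is Bessel if there is $b>0$ with $\sum_{i=1}^m|\langle f,f_i\rangle|^2\le b\|f\|^2$ for all $f\in\mathcal{H}$; its frame operator is $Sf=\sum_{i=1}^m\langle f,f_i\rangle f_i$. It is a tight frame for $\mathcal{H}$ if its frame operator is $cI$ for some $c>0$. For $r\in\mathbb{N}\cup\{\infty\}$, $\mathcal{F}$ is called $(\mathbf{a},r)$-completable if there is a Bessel sequence $\mathcal{G}=\{g_i\}_{i=1}^r\subset\mathcal{H}$ with $\|g_i\|^2=a_i$ for $1\le i\le r$ (for all $i\ge1$ if $r=\infty$) such that the concatenated sequence $\mathcal{F}\cup\mathcal{G}$ is a tight frame for $\mathcal{H}$. If $\sum_i a_i$ diverges, $\sum_{i=1}^\infty a_i$ is read as $+\infty$.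
   Formalization: Case 1 fails as written when r_0=n (e.g. n=1, r_0=1) and c_{r_0} is undefined for r_0>n; proved instead: r_0<n iff c_k=(1/n)(a_1+...+a_k+α) for some 1≤k≤n-1, and this equation holds at k=r_0 if r_0<n. In Case 2 the minimum is over finite r. *)

theory Defs
  imports "HOL-Analysis.Analysis" "HOL-Library.Extended_Nat"
begin

text \<open>
  A type class whose only models are the real field (\<open>im_unit = 0\<close>) and the complex field
  (\<open>im_unit\<close> a square root of \<open>-1\<close>), so that real and complex Hilbert spaces
  can be treated together.
\<close>

class real_or_complex = real_normed_field +
  fixes kconj :: "'a \<Rightarrow> 'a"
    and im_unit :: "'a"
  assumes im_unit_cases: "im_unit = 0 \<or> im_unit * im_unit = - 1"
    and real_im_decomp: "\<exists>s t. x = s *\<^sub>R 1 + t *\<^sub>R im_unit"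
    and kconj_decomp: "kconj (s *\<^sub>R 1 + t *\<^sub>R im_unit) = s *\<^sub>R 1 - t *\<^sub>R im_unit"

instantiation real :: real_or_complex
begin

definition kconj_real :: "real \<Rightarrow> real" where "kconj_real x = x"
definition im_unit_real :: real where "im_unit_real = 0"

instance
  by standard (auto simp: kconj_real_def im_unit_real_def)

end

instantiation complex :: real_or_complex
begin

definition kconj_complex :: "complex \<Rightarrow> complex" where "kconj_complex = cnj"
definition im_unit_complex :: complex where "im_unit_complex = \<i>"

instance
proof
  show "(im_unit::complex) = 0 \<or> im_unit * im_unit = (- 1 :: complex)"
    by (simp add: im_unit_complex_def)
  show "\<exists>s t. x = s *\<^sub>R 1 + t *\<^sub>R im_unit" for x :: complex
    by (rule exI[of _ "Re x"], rule exI[of _ "Im x"])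
       (simp add: im_unit_complex_def complex_eq_iff)
  show "kconj (s *\<^sub>R 1 + t *\<^sub>R im_unit) = s *\<^sub>R 1 - t *\<^sub>R (im_unit :: complex)" for s t
    by (simp add: im_unit_complex_def kconj_complex_def complex_eq_iff)
qed

end

text \<open>
  The class \<open>banach\<close> provides the norm and completeness; the last two axioms say that its
  real scalar multiplication and its norm are the ones determined by \<open>smul\<close> and \<open>ip\<close>.
  The inner product is linear in the first argument.
\<close>

locale hilbert_space = vector_space smul
  for smul :: "'k::real_or_complex \<Rightarrow> 'a::banach \<Rightarrow> 'a" +
  fixes ip :: "'a \<Rightarrow> 'a \<Rightarrow> 'k"
  assumes ip_add_left: "ip (x + y) z = ip x z + ip y z"
    and ip_scale_left: "ip (smul c x) y = c * ip x y"
    and ip_conj: "ip y x = kconj (ip x y)"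
    and ip_self: "ip x x = of_real ((norm x)\<^sup>2)"
    and scale_of_real: "smul (of_real s) x = s *\<^sub>R x"

lemma hilbert_space_real:
  "hilbert_space scaleR (inner :: 'a::{banach, real_inner} \<Rightarrow> 'a \<Rightarrow> real)"
  by unfold_locales
     (auto simp: algebra_simps inner_commute kconj_real_def power2_norm_eq_inner)

lemma hilbert_space_complex:
  "hilbert_space (*s) (\<lambda>x y :: complex ^ 'n. \<Sum>i\<in>UNIV. x $ i * cnj (y $ i))"
proof unfold_locales
  show "(\<Sum>i\<in>UNIV. x $ i * cnj (x $ i)) = of_real ((norm x)\<^sup>2)" for x :: "complex ^ 'n"
    by (simp add: norm_vec_def L2_set_def sum_nonneg complex_norm_square del: of_real_power)
  show "of_real s *s x = s *\<^sub>R x" for s and x :: "complex ^ 'n"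
    unfolding vec_eq_iff by (simp add: scaleR_conv_of_real[where 'a = complex])
qed (auto simp: vec_eq_iff algebra_simps sum.distrib sum_distrib_left kconj_complex_def)

text \<open>
  Sequences are indexed from \<open>1\<close>; the value of the underlying function at indices outside
  \<open>idx m\<close> is irrelevant.
\<close>

definition idx :: "enat \<Rightarrow> nat set" where
  "idx m = {i. 1 \<le> i \<and> enat i \<le> m}"

definition bessel :: "('a \<Rightarrow> 'a \<Rightarrow> 'k::real_or_complex) \<Rightarrow> enat \<Rightarrow> (nat \<Rightarrow> 'a::banach) \<Rightarrow> bool" where
  "bessel ip m h \<longleftrightarrow> (\<exists>b>0. \<forall>x.
     (\<lambda>i. (norm (ip x (h i)))\<^sup>2) summable_on idx m \<and>
     (\<Sum>\<^sub>\<infinity>i\<in>idx m. (norm (ip x (h i)))\<^sup>2) \<le> b * (norm x)\<^sup>2)"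

definition frame_operator ::
  "('k::real_or_complex \<Rightarrow> 'a::banach \<Rightarrow> 'a) \<Rightarrow> ('a \<Rightarrow> 'a \<Rightarrow> 'k) \<Rightarrow> enat \<Rightarrow> (nat \<Rightarrow> 'a) \<Rightarrow> 'a \<Rightarrow> 'a" where
  "frame_operator smul ip m h x = (\<Sum>\<^sub>\<infinity>i\<in>idx m. smul (ip x (h i)) (h i))"

definition tight_frame ::
  "('k::real_or_complex \<Rightarrow> 'a::banach \<Rightarrow> 'a) \<Rightarrow> ('a \<Rightarrow> 'a \<Rightarrow> 'k) \<Rightarrow> enat \<Rightarrow> (nat \<Rightarrow> 'a) \<Rightarrow> bool" where
  "tight_frame smul ip m h \<longleftrightarrow> bessel ip m h \<and>
     (\<exists>c>0. \<forall>x. frame_operator smul ip m h x = c *\<^sub>R x)"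

definition concat_seq :: "nat \<Rightarrow> (nat \<Rightarrow> 'a) \<Rightarrow> (nat \<Rightarrow> 'a) \<Rightarrow> nat \<Rightarrow> 'a" where
  "concat_seq p f g i = (if i \<le> p then f i else g (i - p))"

definition completable ::
  "('k::real_or_complex \<Rightarrow> 'a::banach \<Rightarrow> 'a) \<Rightarrow> ('a \<Rightarrow> 'a \<Rightarrow> 'k) \<Rightarrow>
   nat \<Rightarrow> (nat \<Rightarrow> 'a) \<Rightarrow> (nat \<Rightarrow> real) \<Rightarrow> enat \<Rightarrow> bool" where
  "completable smul ip p f a r \<longleftrightarrow>
     (\<exists>g. bessel ip r g \<and> (\<forall>i\<in>idx r. (norm (g i))\<^sup>2 = a i) \<and>
          tight_frame smul ip (enat p + r) (concat_seq p f g))"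

text \<open>
  The trace of the matrix of \<open>T\<close> with respect to a basis. It does not depend on the basis;
  \<open>extend_basis {}\<close> is an arbitrary one.
\<close>

definition op_trace :: "('k::field \<Rightarrow> 'a::ab_group_add \<Rightarrow> 'a) \<Rightarrow> ('a \<Rightarrow> 'a) \<Rightarrow> 'k" where
  "op_trace smul T =
     (let B = vector_space.extend_basis smul {} in \<Sum>b\<in>B. module.representation smul B (T b) b)"

text \<open>
  \<open>lam 1 \<ge> \<dots> \<ge> lam n\<close> lists the eigenvalues of \<open>T\<close>, each repeated according to the dimension
  of its eigenspace. For self-adjoint \<open>T\<close>, such as a frame operator, all eigenvalues are real
  and this is also the algebraic multiplicity.
\<close>

definition ordered_eigenvalues ::
  "('k::real_or_complex \<Rightarrow> 'a::ab_group_add \<Rightarrow> 'a) \<Rightarrow> ('a \<Rightarrow> 'a) \<Rightarrow> nat \<Rightarrow> (nat \<Rightarrow> real) \<Rightarrow> bool" where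
  "ordered_eigenvalues smul T n lam \<longleftrightarrow>
     (\<forall>i j. 1 \<le> i \<and> i \<le> j \<and> j \<le> n \<longrightarrow> lam j \<le> lam i) \<and>
     (\<forall>\<mu>. vector_space.dim smul {v. T v = smul \<mu> v} =
           card {i\<in>{1..n}. of_real (lam i) = \<mu>})"

fun c_seq :: "nat \<Rightarrow> (nat \<Rightarrow> real) \<Rightarrow> (nat \<Rightarrow> real) \<Rightarrow> nat \<Rightarrow> real" where
  "c_seq n lam a 0 = lam 1"
| "c_seq n lam a (Suc k) =
     max (c_seq n lam a k) ((\<Sum>i=1..Suc k. a i + lam (n - i + 1)) / real (Suc k))"

end

theory Submission
  imports Defs
begin

text \<open>
  Let \<open>S\<close> be the frame operator of the given sequence. Adding vectors \<open>g i\<close> makes it tight with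
  constant \<open>c\<close> exactly if the frame operator of the \<open>g i\<close> is \<open>c I - S\<close>, whose eigenvalues in
  nonincreasing order are \<open>mu l = c - lam (n - l + 1)\<close>. Comparing traces shows that
  \<open>c = ((\<Sum>i. a i) + \<alpha>) / n\<close>, the sum running over the added vectors. So the question is which
  squared norms \<open>a i\<close> are possible for vectors with a prescribed frame operator, and the answer
  is the Schur-Horn theorem: \<open>mu\<close> must be nonnegative and \<open>a\<close> must be majorized by \<open>mu\<close>.

  Necessity (\<open>norms_majorized\<close>) holds because the matrix of the numbers
  \<open>|\<langle>g i, u l\<rangle>|\<^sup>2 / mu l\<close>, for an orthonormal eigenbasis \<open>u\<close>, is doubly substochastic.
  Sufficiency (\<open>frame_operator_with_majorized_norms\<close>) starts from the vectors
  \<open>sqrt (mu l) u l\<close> and corrects their norms by rotating two vectors at a time, which does not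
  change the frame operator; majorization is what makes finitely many such corrections enough
  (\<open>majorized_reachable_by_transfers\<close>).

  Unfolding the definition of \<open>c_k\<close>, these inequalities say that \<open>r\<close> vectors suffice, for
  finite \<open>r\<close>, exactly if \<open>c_k \<le> ((\<Sum>i\<le>r. a i) + \<alpha>) / n\<close> with \<open>k = min n r\<close>
  (\<open>completable_enat_iff\<close>). For \<open>r < n\<close> the reverse inequality always holds
  (\<open>c_seq_lower_bound\<close>), which gives the equation of the first case; for \<open>r \<ge> n\<close> the left-hand
  side is the constant \<open>c_n\<close>, which gives the second case. Infinitely many vectors can suffice
  only if \<open>a\<close> is summable and \<open>c_n\<close> is at most the limit of the right-hand sides
  (\<open>completable_infinity_imp\<close>). Were it smaller, a finite number of vectors would do; so
  equality holds if infinitely many are needed. Conversely, if \<open>c_n\<close> equals the limit, no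
  right-hand side reaches it, because \<open>a\<close> is positive.
\<close>

section \<open>Conjugation and norm of the scalar field\<close>

text \<open>
  A bound that holds for all powers up to one fixed factor holds without the factor, since
  \<open>(u / v) ^ k\<close> would be unbounded otherwise.
\<close>

lemma le_of_power_le_mult_power:
  fixes u v C :: real
  assumes "u \<ge> 0" "v \<ge> 0" and bound: "\<And>k::nat. u ^ k \<le> C * v ^ k"
  shows "u \<le> v"
proof (rule ccontr)
  assume "\<not> u \<le> v"
  then have uv: "v < u" by simp
  show False
  proof (cases "v = 0")
    case True
    then show False using bound[of 1] uv by simp
  next
    case False
    then have v: "v > 0" using assms by simp
    then obtain k where "C < (u / v) ^ k"
      using real_arch_pow[of "u / v" C] uv by (auto simp: field_simps)
    then show False using bound[of k] v by (simp add: power_divide field_simps)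
  qed
qed

lemma kconj_of_real [simp]: "kconj (of_real s) = (of_real s :: 'k::real_or_complex)"
  using kconj_decomp[of s 0, where 'a = 'k] by (simp add: of_real_def)

text \<open>
  If the imaginary unit is \<open>0\<close>, the coordinate \<open>t\<close> is arbitrary; choosing \<open>t = 0\<close> makes the
  usual formulas for products hold in the real and in the complex case alike.
\<close>

lemma real_imag_cases:
  fixes x :: "'k::real_or_complex"
  obtains s t where "x = of_real s + of_real t * im_unit"
    and "kconj x = of_real s - of_real t * im_unit"
    and "(im_unit :: 'k) * im_unit = - 1 \<or> (im_unit = (0::'k) \<and> t = 0)"
proof (cases "im_unit = (0::'k)")
  case True
  obtain s t where "x = s *\<^sub>R 1 + t *\<^sub>R im_unit" using real_im_decomp by blast
  then have "x = of_real s" using True by (simp add: of_real_def)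
  then show ?thesis using that[of s 0] True by simp
next
  case False
  obtain s t where x: "x = s *\<^sub>R 1 + t *\<^sub>R im_unit" using real_im_decomp by blast
  have "kconj x = s *\<^sub>R 1 - t *\<^sub>R im_unit" unfolding x by (rule kconj_decomp)
  then show ?thesis using that[of s t] x False im_unit_cases[where 'a='k]
    by (simp add: scaleR_conv_of_real)
qed

lemma kconj_add: "kconj (x + y) = kconj x + (kconj y :: 'k::real_or_complex)"
proof -
  obtain s t where x: "x = s *\<^sub>R 1 + t *\<^sub>R im_unit" using real_im_decomp by blast
  obtain s' t' where y: "y = s' *\<^sub>R 1 + t' *\<^sub>R im_unit" using real_im_decomp by blast
  have "x + y = (s + s') *\<^sub>R 1 + (t + t') *\<^sub>R im_unit"
    unfolding x y by (simp add: algebra_simps)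
  then have "kconj (x + y) = (s + s') *\<^sub>R 1 - (t + t') *\<^sub>R im_unit"
    by (simp only: kconj_decomp)
  also have "\<dots> = kconj x + kconj y"
    unfolding x y kconj_decomp by (simp add: algebra_simps)
  finally show ?thesis .
qed

lemma kconj_kconj [simp]: "kconj (kconj x) = (x :: 'k::real_or_complex)"
proof -
  obtain s t where x: "x = s *\<^sub>R 1 + t *\<^sub>R im_unit" using real_im_decomp by blast
  have "kconj x = s *\<^sub>R 1 + (- t) *\<^sub>R im_unit" unfolding x kconj_decomp by simp
  then have "kconj (kconj x) = s *\<^sub>R 1 - (- t) *\<^sub>R im_unit" by (simp only: kconj_decomp)
  then show ?thesis using x by simp
qed

lemma kconj_mult: "kconj (x * y) = kconj x * (kconj y :: 'k::real_or_complex)"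
proof -
  obtain s t where x: "x = of_real s + of_real t * im_unit"
    and cx: "kconj x = of_real s - of_real t * im_unit"
    and i: "(im_unit :: 'k) * im_unit = - 1 \<or> (im_unit = (0::'k) \<and> t = 0)"
    by (rule real_imag_cases)
  obtain s' t' where y: "y = of_real s' + of_real t' * im_unit"
    and cy: "kconj y = of_real s' - of_real t' * im_unit"
    by (rule real_imag_cases)
  define d where "d = (if im_unit = (0::'k) then 0 else -1 :: real)"
  have ii: "(im_unit :: 'k) * im_unit = of_real d"
    using i by (auto simp: d_def)
  have "x * y = of_real s * of_real s' + of_real t * of_real t' * (im_unit * im_unit)
      + (of_real s * of_real t' + of_real s' * of_real t) * im_unit"
    unfolding x y by (simp add: algebra_simps)
  then have xy: "x * y = (s * s' + t * t' * d) *\<^sub>R 1 + (s * t' + s' * t) *\<^sub>R im_unit"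
    unfolding ii by (simp add: scaleR_conv_of_real)
  have "kconj (x * y) = (s * s' + t * t' * d) *\<^sub>R 1 - (s * t' + s' * t) *\<^sub>R im_unit"
    unfolding xy by (rule kconj_decomp)
  also have "\<dots> = of_real s * of_real s' + of_real t * of_real t' * (im_unit * im_unit)
      - (of_real s * of_real t' + of_real s' * of_real t) * im_unit"
    unfolding ii by (simp add: scaleR_conv_of_real)
  also have "\<dots> = kconj x * kconj y"
    unfolding cx cy by (simp add: algebra_simps)
  finally show ?thesis .
qed

lemma kconj_power: "kconj (x ^ k) = (kconj x :: 'k::real_or_complex) ^ k"
  using kconj_of_real[of 1] by (induction k) (auto simp: kconj_mult)

text \<open>
  The class fixes a multiplicative norm but does not say that it is the Euclidean norm of
  the coordinates. The triangle inequality bounds it by twice that norm.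
\<close>

lemma mult_kconj_of_real:
  fixes x :: "'k::real_or_complex"
  obtains q where "q \<ge> 0" "x * kconj x = of_real q" "norm x \<le> 2 * sqrt q"
proof -
  obtain s t where x: "x = of_real s + of_real t * im_unit"
    and cx: "kconj x = of_real s - of_real t * im_unit"
    and i: "(im_unit :: 'k) * im_unit = - 1 \<or> (im_unit = (0::'k) \<and> t = 0)"
    by (rule real_imag_cases)
  have "x * kconj x = of_real s * of_real s - of_real t * of_real t * (im_unit * im_unit)"
    unfolding cx by (simp add: x algebra_simps)
  also have "\<dots> = of_real (s\<^sup>2 + t\<^sup>2)"
    using i by (auto simp: power2_eq_square)
  finally have q: "x * kconj x = of_real (s\<^sup>2 + t\<^sup>2)" .
  have "norm (im_unit :: 'k) * norm (im_unit :: 'k) \<le> 1"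
    using i norm_mult[of "im_unit::'k" im_unit] by auto
  then have "norm (im_unit :: 'k) \<le> 1"
    by (metis abs_norm_cancel abs_square_le_1 power2_eq_square)
  then have "norm x \<le> \<bar>s\<bar> + \<bar>t\<bar> * 1"
    unfolding x by (intro order_trans[OF norm_triangle_ineq] add_mono)
      (auto simp: norm_mult mult_left_le)
  also have "\<bar>s\<bar> + \<bar>t\<bar> * 1 \<le> sqrt (s\<^sup>2 + t\<^sup>2) + sqrt (s\<^sup>2 + t\<^sup>2)"
    by (intro add_mono) (auto intro!: real_le_rsqrt)
  finally have "norm x \<le> 2 * sqrt (s\<^sup>2 + t\<^sup>2)" by simp
  with q show thesis by (intro that[of "s\<^sup>2 + t\<^sup>2"]) auto
qed

text \<open>
  Both \<open>x\<close> and \<open>kconj x\<close> have norm at most \<open>sqrt q\<close>: the factor \<open>2\<close> of the crude bound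
  disappears when the bound is applied to all powers of an element, because the norm is
  multiplicative. As the product of the two norms is \<open>q\<close>, both bounds are equalities.
\<close>

lemma mult_kconj: "x * kconj x = (of_real ((norm x)\<^sup>2) :: 'k::real_or_complex)"
proof -
  obtain q where q0: "q \<ge> 0" and q: "x * kconj x = of_real q"
    by (rule mult_kconj_of_real)
  have le: "norm y \<le> sqrt q" if y: "y * kconj y = of_real q" for y :: 'k
  proof (rule le_of_power_le_mult_power)
    show "norm y ^ k \<le> 2 * sqrt q ^ k" for k
    proof -
      have "y ^ k * kconj (y ^ k) = of_real (q ^ k)"
        using y by (simp add: kconj_power flip: power_mult_distrib)
      then show ?thesis
        by (metis mult_kconj_of_real norm_power of_real_eq_iff real_sqrt_power)
    qed
  qed (use q0 in auto)
  have 1: "norm x \<le> sqrt q" using le q by simp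
  have 2: "norm (kconj x) \<le> sqrt q" using le[of "kconj x"] q by (simp add: mult.commute)
  have 3: "norm x * norm (kconj x) = q"
    using arg_cong[OF q, of norm] q0 by (simp add: norm_mult)
  have "norm x = sqrt q"
  proof (rule ccontr)
    assume "norm x \<noteq> sqrt q"
    with 1 have lt: "norm x < sqrt q" by simp
    then have pos: "sqrt q > 0" using norm_ge_zero[of x] by linarith
    have "norm x * norm (kconj x) \<le> norm x * sqrt q" using 2 by (rule mult_left_mono) simp
    also have "\<dots> < sqrt q * sqrt q" using lt pos by (rule mult_strict_right_mono)
    finally show False using 3 q0 by simp
  qed
  then show ?thesis using q q0 by simp
qed

section \<open>Inner products\<close>

lemma has_sum_of_real_iff:
  "((\<lambda>i. of_real (h i) :: 'k::real_normed_div_algebra) has_sum of_real s) A \<longleftrightarrow> (h has_sum s) A"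
proof -
  have "sum (\<lambda>i. of_real (h i) :: 'k) = (\<lambda>F. of_real (sum h F))"
    by (rule ext) simp
  then show ?thesis by (simp only: has_sum_def tendsto_of_real_iff)
qed

context hilbert_space
begin

lemma ip_zero_left [simp]: "ip 0 y = 0"
  using ip_add_left[of 0 0 y] by simp

lemma ip_zero_right [simp]: "ip x 0 = 0"
  using kconj_of_real[of 0, where 'k='k] by (simp add: ip_conj[of x 0])

lemma ip_add_right: "ip x (y + z) = ip x y + ip x z"
  by (simp add: ip_conj[of x] ip_add_left kconj_add)

lemma ip_scale_right: "ip x (smul c y) = kconj c * ip x y"
  by (simp add: ip_conj[of x] ip_scale_left kconj_mult)

lemma ip_scaleR_left: "ip (s *\<^sub>R x) y = of_real s * ip x y"
  by (metis ip_scale_left scale_of_real)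

lemma ip_scaleR_right: "ip x (s *\<^sub>R y) = of_real s * ip x y"
  by (metis ip_scale_right kconj_of_real scale_of_real)

lemma ip_diff_left: "ip (x - y) z = ip x z - ip y z"
  using ip_add_left[of "x - y" y z] by simp

lemma ip_diff_right: "ip z (x - y) = ip z x - ip z y"
  using ip_add_right[of z "x - y" y] by simp

lemma ip_sum_left: "ip (sum h A) y = (\<Sum>i\<in>A. ip (h i) y)"
  by (induction A rule: infinite_finite_induct) (auto simp: ip_add_left)

lemma ip_sum_right: "ip y (sum h A) = (\<Sum>i\<in>A. ip y (h i))"
  by (induction A rule: infinite_finite_induct) (auto simp: ip_add_right)

lemma ip_self_eq_0_iff [simp]: "ip x x = 0 \<longleftrightarrow> x = 0"
  by (simp add: ip_self)

lemma ip_mult_ip_commute: "ip x y * ip y x = of_real ((norm (ip x y))\<^sup>2)"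
  by (simp only: ip_conj[of y x] mult_kconj)

lemma norm_ip_commute: "norm (ip x y) = norm (ip y x)"
proof -
  have "of_real ((norm (ip x y))\<^sup>2) = (of_real ((norm (ip y x))\<^sup>2) :: 'k)"
    by (simp only: ip_mult_ip_commute [symmetric] mult.commute)
  then show ?thesis by (simp only: of_real_eq_iff) simp
qed

text \<open>
  \<open>t y\<close> is the projection of \<open>x\<close> onto the line of \<open>y\<close>; the inequality says that the rest
  \<open>x - t y\<close> has nonnegative squared norm.
\<close>

lemma Cauchy_Schwarz_ip: "norm (ip x y) \<le> norm x * norm y"
proof (cases "y = 0")
  case False
  define t where "t = ip x y / ip y y"
  have yy: "ip y y \<noteq> 0" using False by simp
  have "ip (x - smul t y) (smul t y) = 0"
    using yy by (simp add: ip_scale_right ip_diff_left ip_scale_left t_def)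
  then have "ip (x - smul t y) (x - smul t y) = ip (x - smul t y) x"
    by (simp add: ip_diff_right)
  also have "\<dots> = ip x x - ip x y * ip y x / ip y y"
    by (simp add: ip_diff_left ip_scale_left t_def)
  finally have "of_real ((norm (x - smul t y))\<^sup>2)
      = (of_real ((norm x)\<^sup>2 - (norm (ip x y))\<^sup>2 / (norm y)\<^sup>2) :: 'k)"
    by (simp only: ip_self ip_mult_ip_commute of_real_diff of_real_divide)
  then have "(norm (x - smul t y))\<^sup>2 = (norm x)\<^sup>2 - (norm (ip x y))\<^sup>2 / (norm y)\<^sup>2"
    by (simp only: of_real_eq_iff)
  then have "(norm (ip x y))\<^sup>2 / (norm y)\<^sup>2 \<le> (norm x)\<^sup>2"
    by (metis diff_ge_0_iff_ge zero_le_power2)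
  then have "(norm (ip x y))\<^sup>2 \<le> (norm x * norm y)\<^sup>2"
    using False by (simp add: field_simps power_mult_distrib)
  then show ?thesis by (rule power2_le_imp_le) simp
qed simp

lemma tendsto_ip_left: "((\<lambda>x. ip x y) \<longlongrightarrow> ip z y) (at z)"
proof -
  have "bounded_linear (\<lambda>x. ip x y)"
    by (rule bounded_linear_intro[where K = "norm y"])
      (auto simp: ip_add_left ip_scaleR_left Cauchy_Schwarz_ip scaleR_conv_of_real[where 'a='k])
  then show ?thesis by (rule bounded_linear.tendsto) (rule tendsto_ident_at)
qed

text \<open>
  Continuity of the inner product lets it be taken termwise, which is how the tightness
  of an infinite sequence is turned into scalar identities.
\<close>

lemma has_sum_ip_left:
  assumes "(h has_sum x) A"
  shows "((\<lambda>i. ip (h i) y) has_sum ip x y) A"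
proof -
  have "Modules.additive (\<lambda>x. ip x y)" by unfold_locales (rule ip_add_left)
  from has_sum_comm_additive[OF this tendsto_ip_left assms] show ?thesis
    by (simp add: o_def)
qed

lemma norm_eq_1_if:
  assumes "ip u u = 1" shows "norm u = 1"
proof -
  have "of_real ((norm u)\<^sup>2) = (of_real 1 :: 'k)" using assms by (simp only: ip_self of_real_1)
  then have "(norm u)\<^sup>2 = 1" by (simp only: of_real_eq_iff)
  then show ?thesis using power2_eq_1_iff[of "norm u"] norm_ge_zero[of u] by linarith
qed

definition orthonormal :: "nat \<Rightarrow> (nat \<Rightarrow> 'a) \<Rightarrow> bool" where
  "orthonormal m u \<longleftrightarrow> (\<forall>i\<in>{1..m}. \<forall>j\<in>{1..m}. ip (u i) (u j) = (if i = j then 1 else 0))"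

end

section \<open>Orthonormal eigenbases and traces\<close>

context hilbert_space
begin

lemma orthonormalD:
  assumes "orthonormal m u" "i \<in> {1..m}" "j \<in> {1..m}"
  shows "ip (u i) (u j) = (if i = j then 1 else 0)"
  using assms by (auto simp: orthonormal_def)

lemma ip_orthonormal_expansion:
  assumes u: "orthonormal m u" and J: "J \<subseteq> {1..m}" and k: "k \<in> J"
  shows "ip (\<Sum>i\<in>J. smul (z i) (u i)) (u k) = z k"
proof -
  have fin: "finite J" using J finite_subset by blast
  have "ip (\<Sum>i\<in>J. smul (z i) (u i)) (u k) = (\<Sum>i\<in>J. if i = k then z k else 0)"
    unfolding ip_sum_left ip_scale_left
    using orthonormalD[OF u] J k by (intro sum.cong) (auto simp: subset_iff)
  then show ?thesis using k fin by simp
qed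

lemma residual_orthogonal:
  assumes "orthonormal m u" "J \<subseteq> {1..m}" "k \<in> J"
  shows "ip (v - (\<Sum>i\<in>J. smul (ip v (u i)) (u i))) (u k) = 0"
  using ip_orthonormal_expansion[OF assms, of "\<lambda>i. ip v (u i)"] by (simp add: ip_diff_left)

lemma orthonormal_inj_on:
  assumes "orthonormal m u" shows "inj_on u {1..m}"
  by (rule inj_onI) (metis orthonormalD[OF assms] zero_neq_one)

lemma orthonormal_independent:
  assumes u: "orthonormal m u" shows "independent (u ` {1..m})"
proof -
  have inj: "inj_on u {1..m}" using u by (rule orthonormal_inj_on)
  have "w (u k) = 0" if "(\<Sum>v\<in>u ` {1..m}. smul (w v) v) = 0" "k \<in> {1..m}" for w k
    using ip_orthonormal_expansion[OF u subset_refl that(2), of "w \<circ> u"] that(1)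
    by (simp del: One_nat_def add: sum.reindex[OF inj] o_def)
  then show ?thesis
    by (subst dependent_finite) auto
qed

lemma orthonormal_extend:
  assumes u: "orthonormal m u" and v: "v \<noteq> 0" and orth: "\<And>i. i \<in> {1..m} \<Longrightarrow> ip v (u i) = 0"
  shows "orthonormal (Suc m) (u(Suc m := (1 / norm v) *\<^sub>R v))"
proof -
  have 0: "ip (u i) v = 0" if "i \<in> {1..m}" for i
    using orth[OF that] kconj_of_real[of 0, where 'k='k] by (simp add: ip_conj[of "u i"])
  have "ip v v / (of_real (norm v) * of_real (norm v)) = 1"
    using v by (simp add: ip_self power2_eq_square)
  then have 1: "ip ((1 / norm v) *\<^sub>R v) ((1 / norm v) *\<^sub>R v) = 1"
    by (simp add: ip_scaleR_left ip_scaleR_right)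
  show ?thesis
    unfolding orthonormal_def
    using orthonormalD[OF u] orth 0 1
    by (auto simp: ip_scaleR_left ip_scaleR_right le_Suc_eq)
qed

lemma finite_basis_if_dim_pos:
  assumes "dim UNIV = n" "n \<ge> 1"
  obtains B where "finite B" "independent B" "span B = UNIV" "card B = n"
  by (metis assms basis_exists card.infinite not_one_le_zero top.extremum_uniqueI)

text \<open>
  If the residual of \<open>x\<close> were nonzero, normalizing it would give \<open>n + 1\<close> orthonormal, hence
  independent, vectors in a space of dimension \<open>n\<close>.
\<close>

lemma orthonormal_basis_expansion:
  assumes dim: "dim UNIV = n" "n \<ge> 1" and u: "orthonormal n u"
  shows "x = (\<Sum>i\<in>{1..n}. smul (ip x (u i)) (u i))"
proof (rule ccontr)
  define v where "v = x - (\<Sum>i\<in>{1..n}. smul (ip x (u i)) (u i))"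
  assume "x \<noteq> (\<Sum>i\<in>{1..n}. smul (ip x (u i)) (u i))"
  then have v: "v \<noteq> 0" by (simp add: v_def)
  have "orthonormal (Suc n) (u(Suc n := (1 / norm v) *\<^sub>R v))" (is "orthonormal _ ?w")
    using residual_orthogonal[OF u subset_refl] by (intro orthonormal_extend[OF u v]) (simp add: v_def)
  then have ind: "independent (?w ` {1..Suc n})" and card: "card (?w ` {1..Suc n}) = Suc n"
    using orthonormal_independent card_image[OF orthonormal_inj_on] by (fastforce, fastforce)
  obtain B where B: "finite B" "span B = UNIV" "card B = n"
    using finite_basis_if_dim_pos[OF dim] by metis
  have "card (?w ` {1..Suc n}) \<le> n"
    using independent_span_bound[OF B(1) ind] B by auto
  then show False using card by simp
qed

lemma Parseval:
  assumes dim: "dim UNIV = n" "n \<ge> 1" and u: "orthonormal n u"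
  shows "(norm x)\<^sup>2 = (\<Sum>i\<in>{1..n}. (norm (ip x (u i)))\<^sup>2)"
proof -
  have "ip x x = ip (\<Sum>i\<in>{1..n}. smul (ip x (u i)) (u i)) x"
    using orthonormal_basis_expansion[OF assms, of x] by simp
  also have "\<dots> = (\<Sum>i\<in>{1..n}. of_real ((norm (ip x (u i)))\<^sup>2))"
    by (simp only: ip_sum_left ip_scale_left ip_mult_ip_commute)
  finally have "of_real ((norm x)\<^sup>2) = (of_real (\<Sum>i\<in>{1..n}. (norm (ip x (u i)))\<^sup>2) :: 'k)"
    by (simp only: ip_self of_real_sum)
  then show ?thesis by (simp only: of_real_eq_iff)
qed

text \<open>
  Let \<open>\<phi>\<^sub>b\<close> be the coordinate functionals of the basis \<open>B\<close>. Expanding \<open>b\<close> in the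
  orthonormal basis and \<open>T (u i)\<close> in \<open>B\<close> turns both sides into the double sum of
  \<open>\<langle>b, u i\<rangle> \<phi>\<^sub>b (T (u i))\<close>.
\<close>

lemma trace_orthonormal_basis:
  assumes dim: "dim UNIV = n" "n \<ge> 1" and u: "orthonormal n u"
    and lin: "Vector_Spaces.linear smul smul T"
  shows "op_trace smul T = (\<Sum>i\<in>{1..n}. ip (T (u i)) (u i))"
proof -
  interpret T: Vector_Spaces.linear smul smul T by (rule lin)
  define B where "B = extend_basis {}"
  have B: "independent B" "span B = UNIV"
    using independent_extend_basis[OF independent_empty] span_extend_basis[OF independent_empty]
    by (auto simp: B_def)
  obtain B0 where "finite B0" "span B0 = UNIV"
    using finite_basis_if_dim_pos[OF dim] by metis
  then have finB: "finite B" using independent_span_bound[of B0 B] B by simp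
  let ?R = "representation B"
  have exp: "(\<Sum>b\<in>B. smul (?R v b) b) = v" for v
    using sum_representation_eq[OF B(1) _ finB subset_refl, of v] B(2) by simp
  have "ip (T (u i)) (u i) = (\<Sum>b\<in>B. ip b (u i) * ?R (T (u i)) b)" for i
  proof -
    have "ip (T (u i)) (u i) = ip (\<Sum>b\<in>B. smul (?R (T (u i)) b) b) (u i)" by (simp add: exp)
    also have "\<dots> = (\<Sum>b\<in>B. ip b (u i) * ?R (T (u i)) b)"
      by (simp only: ip_sum_left ip_scale_left mult.commute)
    finally show ?thesis .
  qed
  then have "(\<Sum>i\<in>{1..n}. ip (T (u i)) (u i))
      = (\<Sum>b\<in>B. \<Sum>i\<in>{1..n}. ip b (u i) * ?R (T (u i)) b)"
    by (simp add: sum.swap[of _ B])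
  also have "\<dots> = (\<Sum>b\<in>B. ?R (T b) b)"
  proof (rule sum.cong[OF refl])
    fix b assume "b \<in> B"
    have "T b = (\<Sum>i\<in>{1..n}. smul (ip b (u i)) (T (u i)))"
      by (subst orthonormal_basis_expansion[OF dim u, of b]) (simp add: T.sum T.scale)
    then show "(\<Sum>i\<in>{1..n}. ip b (u i) * ?R (T (u i)) b) = ?R (T b) b"
      using B by (simp add: representation_sum representation_scale)
  qed
  finally show ?thesis unfolding op_trace_def B_def Let_def by simp
qed

text \<open>
  The eigenspaces are large enough for the listed eigenvalues, so an orthonormal family of
  eigenvectors can be built one vector at a time. For the next
  eigenvalue, the eigenvectors already chosen from its eigenspace are fewer than the dimension
  of this eigenspace, so a vector of the eigenspace lies outside their span; its residual is
  the next eigenvector. Orthogonality to the other eigenspaces is automatic because \<open>T\<close> is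
  self-adjoint.
\<close>

lemma orthonormal_eigenvectors:
  assumes lin: "Vector_Spaces.linear smul smul T"
    and self_adjoint: "\<And>x y. ip (T x) y = ip x (T y)"
    and mult: "\<And>\<mu>. card {i\<in>{1..n}. of_real (nu i) = \<mu>} \<le> dim {v. T v = smul \<mu> v}"
  shows "m \<le> n \<Longrightarrow> \<exists>u. orthonormal m u \<and> (\<forall>i\<in>{1..m}. T (u i) = nu i *\<^sub>R u i)"
proof (induction m)
  case 0
  show ?case by (auto simp: orthonormal_def)
next
  case (Suc m)
  interpret T: Vector_Spaces.linear smul smul T by (rule lin)
  obtain u where u: "orthonormal m u" and Tu: "\<And>i. i \<in> {1..m} \<Longrightarrow> T (u i) = nu i *\<^sub>R u i"
    using Suc by auto
  define t where "t = nu (Suc m)"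
  define E where "E = {v. T v = smul (of_real t) v}"
  define J where "J = {i\<in>{1..m}. nu i = t}"
  have J: "J \<subseteq> {1..m}" "finite J" by (auto simp: J_def)
  have "card (u ` J) \<le> card J" using J by (intro card_image_le)
  also have "\<dots> < card {i\<in>{1..n}. nu i = t}"
  proof (rule psubset_card_mono)
    have "Suc m \<in> {i\<in>{1..n}. nu i = t}" "Suc m \<notin> J" "J \<subseteq> {i\<in>{1..n}. nu i = t}"
      using Suc.prems by (auto simp: J_def t_def)
    then show "J \<subset> {i\<in>{1..n}. nu i = t}" by blast
  qed simp
  also have "\<dots> \<le> dim E" using mult[of "of_real t"] by (simp add: E_def)
  finally have "\<not> E \<subseteq> span (u ` J)"
    using dim_le_card[of E "u ` J"] J by auto
  then obtain v where v: "v \<in> E" "v \<notin> span (u ` J)" by blast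
  define w where "w = v - (\<Sum>i\<in>J. smul (ip v (u i)) (u i))"
  have "(\<Sum>i\<in>J. smul (ip v (u i)) (u i)) \<in> span (u ` J)"
    by (intro span_sum span_scale span_base) auto
  then have w0: "w \<noteq> 0" using v by (auto simp: w_def)
  have uJ: "T (u i) = smul (of_real t) (u i)" if "i \<in> J" for i
    using Tu[of i] that by (simp add: J_def scale_of_real)
  have Tw: "T w = smul (of_real t) w"
    using v uJ unfolding w_def E_def
    by (simp add: T.diff T.sum T.scale scale_right_diff_distrib scale_sum_right mult.commute)
  have orth: "ip w (u i) = 0" if i: "i \<in> {1..m}" for i
  proof (cases "i \<in> J")
    case True
    then show ?thesis unfolding w_def by (rule residual_orthogonal[OF u J(1)])
  next
    case False
    have "of_real t * ip w (u i) = of_real (nu i) * ip w (u i)"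
      using self_adjoint[of w "u i"] by (simp add: Tw Tu[OF i] ip_scale_left ip_scaleR_right)
    then show ?thesis using False i by (auto simp: J_def)
  qed
  have "T ((1 / norm w) *\<^sub>R w) = nu (Suc m) *\<^sub>R ((1 / norm w) *\<^sub>R w)"
    using Tw by (simp add: T.scale mult.commute t_def flip: scale_of_real)
  then have "\<forall>i\<in>{1..Suc m}. T ((u(Suc m := (1 / norm w) *\<^sub>R w)) i)
      = nu i *\<^sub>R (u(Suc m := (1 / norm w) *\<^sub>R w)) i"
    using Tu by (auto simp: le_Suc_eq)
  then show ?case
    using orthonormal_extend[OF u w0 orth] by blast
qed

end

section \<open>Frame operators and majorization\<close>

text \<open>
  A linear functional with nonincreasing coefficients, maximized over weights in \<open>[0, 1]\<close> of
  total at most \<open>k\<close>, puts weight \<open>1\<close> on the first \<open>k\<close> coordinates. Subtracting \<open>mu k\<close> from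
  all coefficients reduces this to a comparison term by term.
\<close>

lemma weighted_sum_le_sum_largest:
  fixes mu w :: "nat \<Rightarrow> real"
  assumes k: "k \<in> {1..n}"
    and anti: "\<And>i j. 1 \<le> i \<Longrightarrow> i \<le> j \<Longrightarrow> j \<le> n \<Longrightarrow> mu j \<le> mu i"
    and nonneg: "mu k \<ge> 0"
    and w: "\<And>l. l \<in> {1..n} \<Longrightarrow> 0 \<le> w l" "\<And>l. l \<in> {1..n} \<Longrightarrow> w l \<le> 1"
    and total: "(\<Sum>l=1..n. w l) \<le> real k"
  shows "(\<Sum>l=1..n. mu l * w l) \<le> (\<Sum>l=1..k. mu l)"
proof -
  have "(\<Sum>l=1..n. mu l * w l) = (\<Sum>l=1..n. (mu l - mu k) * w l) + mu k * (\<Sum>l=1..n. w l)"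
    by (simp add: algebra_simps sum_subtractf sum_distrib_left)
  also have "\<dots> \<le> (\<Sum>l=1..n. if l \<in> {1..k} then mu l - mu k else 0) + mu k * real k"
  proof (intro add_mono sum_mono mult_left_mono total nonneg)
    fix l assume l: "l \<in> {1..n}"
    show "(mu l - mu k) * w l \<le> (if l \<in> {1..k} then mu l - mu k else 0)"
    proof (cases "l \<le> k")
      case True
      then show ?thesis using anti[of l k] w[OF l] k l by (auto intro: mult_left_le)
    next
      case False
      then have "mu l \<le> mu k" using anti[of k l] k l by simp
      then show ?thesis using w[OF l] False by (auto intro: mult_nonpos_nonneg)
    qed
  qed
  also have "(\<Sum>l=1..n. if l \<in> {1..k} then mu l - mu k else 0) = (\<Sum>l=1..k. mu l - mu k)"
    using k by (intro sum.mono_neutral_cong_right) auto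
  finally show ?thesis by (simp add: sum_subtractf mult.commute)
qed

text \<open>
  The theorem of Muirhead and of Hardy, Littlewood and Polya: if the partial sums of \<open>b\<close>
  dominate those of the nonincreasing sequence \<open>a\<close> and the totals agree, then \<open>a\<close> is reached
  from \<open>b\<close> by moving mass from larger to smaller entries. The property \<open>P\<close> stands for
  whatever such transfers preserve. Take the first index \<open>j\<close> with a deficit and an earlier
  index \<open>i\<close> with a surplus, and transfer as much as one of the two allows: that index becomes
  correct, and the partial sums still dominate because no deficit occurs before \<open>j\<close>.
\<close>

lemma majorized_reachable_by_transfers:
  fixes a b :: "nat \<Rightarrow> real"
  assumes transfer: "\<And>b i j \<delta>. P b \<Longrightarrow> i \<in> {1..m} \<Longrightarrow> j \<in> {1..m} \<Longrightarrow> i \<noteq> j \<Longrightarrow> 0 \<le> \<delta> \<Longrightarrow>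
        \<delta> \<le> b i - b j \<Longrightarrow> P (b(i := b i - \<delta>, j := b j + \<delta>))"
    and anti: "\<And>i j. 1 \<le> i \<Longrightarrow> i \<le> j \<Longrightarrow> j \<le> m \<Longrightarrow> a j \<le> a i"
    and partial: "\<And>k. k \<le> m \<Longrightarrow> (\<Sum>i=1..k. a i) \<le> (\<Sum>i=1..k. b i)"
    and total: "(\<Sum>i=1..m. a i) = (\<Sum>i=1..m. b i)"
    and start: "P b"
  shows "\<exists>b'. P b' \<and> (\<forall>i\<in>{1..m}. b' i = a i)"
  using partial total start
proof (induction "card {i\<in>{1..m}. b i \<noteq> a i}" arbitrary: b rule: less_induct)
  case less
  show ?case
  proof (cases "\<exists>j\<in>{1..m}. b j < a j")
    case False
    then have "\<forall>i\<in>{1..m}. a i \<le> b i" by (simp add: not_less)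
    then have "\<forall>i\<in>{1..m}. b i = a i"
      using sum_nonneg_eq_0_iff[of "{1..m}" "\<lambda>i. b i - a i"] less.prems(2)
      by (simp add: sum_subtractf)
    then show ?thesis using less.prems(3) by blast
  next
    case True
    then obtain j where j: "j \<in> {1..m}" "b j < a j"
      and least: "\<And>i. i < j \<Longrightarrow> \<not> (i \<in> {1..m} \<and> b i < a i)"
      using exists_least_iff[of "\<lambda>j. j \<in> {1..m} \<and> b j < a j"] by blast
    have before: "a i \<le> b i" if "1 \<le> i" "i < j" for i
      using least[OF that(2)] that j(1) by (auto simp: not_less)
    have "\<exists>i\<in>{1..j-1}. a i < b i"
    proof (rule ccontr)
      assume "\<not> ?thesis"
      then have "(\<Sum>i=1..j-1. b i) \<le> (\<Sum>i=1..j-1. a i)"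
        by (intro sum_mono) (auto simp: not_less)
      moreover have "(\<Sum>i=1..j. h i) = (\<Sum>i=1..j-1. h i) + h j" for h :: "nat \<Rightarrow> real"
        using j(1) by (cases j) auto
      ultimately show False using less.prems(1)[of j] j by auto
    qed
    then obtain i where i: "i \<in> {1..j-1}" "a i < b i" by blast
    define \<delta> where "\<delta> = min (b i - a i) (a j - b j)"
    have \<delta>: "0 \<le> \<delta>" "\<delta> \<le> b i - a i" "\<delta> \<le> a j - b j" using i j by (auto simp: \<delta>_def)
    have ij: "i \<in> {1..m}" "i < j" "i \<noteq> j" using i j by auto
    have "a j \<le> a i" using anti[of i j] ij j by simp
    then have \<delta>2: "\<delta> \<le> b i - b j" using \<delta> i j by linarith
    define b' where "b' = b(i := b i - \<delta>, j := b j + \<delta>)"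
    have sum': "(\<Sum>l=1..k. b' l) = (\<Sum>l=1..k. b l) - (if i \<in> {1..k} then \<delta> else 0)
        + (if j \<in> {1..k} then \<delta> else 0)" for k
    proof -
      have "(\<Sum>l=1..k. b' l)
          = (\<Sum>l=1..k. b l - (if l = i then \<delta> else 0) + (if l = j then \<delta> else 0))"
        using ij by (intro sum.cong) (auto simp: b'_def)
      then show ?thesis by (simp add: sum.distrib sum_subtractf)
    qed
    show ?thesis
    proof (rule less.hyps[of b'])
      have "{l\<in>{1..m}. b' l \<noteq> a l} \<subset> {l\<in>{1..m}. b l \<noteq> a l}"
      proof -
        have "b' i = a i \<or> b' j = a j" using ij by (auto simp: b'_def \<delta>_def min_def)
        moreover have "b' l = b l" if "l \<noteq> i" "l \<noteq> j" for l using that by (simp add: b'_def)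
        ultimately show ?thesis using ij i j by (auto simp: psubset_eq) (metis order_less_irrefl)+
      qed
      then show "card {l\<in>{1..m}. b' l \<noteq> a l} < card {l\<in>{1..m}. b l \<noteq> a l}"
        by (intro psubset_card_mono) auto
      show "(\<Sum>l=1..k. a l) \<le> (\<Sum>l=1..k. b' l)" if k: "k \<le> m" for k
      proof (cases "i \<le> k \<and> k < j")
        case True
        have "\<delta> \<le> b i - a i" by (rule \<delta>)
        also have "\<dots> \<le> (\<Sum>l=1..k. b l - a l)"
          using True before ij by (intro member_le_sum) auto
        finally show ?thesis using True ij sum'[of k] by (simp add: sum_subtractf)
      next
        case False
        then show ?thesis using less.prems(1)[OF k] ij j(1) \<delta>(1) sum'[of k] by auto
      qed
      show "(\<Sum>l=1..m. a l) = (\<Sum>l=1..m. b' l)"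
        using less.prems(2) ij j(1) sum'[of m] by simp
      show "P b'" unfolding b'_def
        by (rule transfer) (use less.prems(3) ij j(1) \<delta> \<delta>2 in auto)
    qed
  qed
qed

context hilbert_space
begin

text \<open>
  The frame operator of a sequence is \<open>V V\<^sup>*\<close> for the matrix \<open>V\<close> with the sequence as
  columns, so it does not change when \<open>V\<close> is multiplied on the right by a rotation.
\<close>

lemma rotate_pair:
  fixes u v :: 'a and c s :: real
  assumes "c\<^sup>2 + s\<^sup>2 = 1"
  defines "u' \<equiv> c *\<^sub>R u + s *\<^sub>R v" and "v' \<equiv> (- s) *\<^sub>R u + c *\<^sub>R v"
  shows "smul (ip x u') u' + smul (ip x v') v' = smul (ip x u) u + smul (ip x v) v"
    and "(norm u')\<^sup>2 + (norm v')\<^sup>2 = (norm u)\<^sup>2 + (norm v)\<^sup>2"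
proof -
  define C S where "C = (of_real c :: 'k)" and "S = (of_real s :: 'k)"
  have "C * C + S * S = of_real (c\<^sup>2 + s\<^sup>2)" by (simp add: C_def S_def power2_eq_square)
  then have CS: "C * C + S * S = 1" by (simp only: assms(1) of_real_1)
  have u': "u' = smul C u + smul S v" and v': "v' = smul (- S) u + smul C v"
    by (auto simp: u'_def v'_def C_def S_def scale_of_real simp flip: of_real_minus)
  have ipu: "ip x u' = C * ip x u + S * ip x v" and ipv: "ip x v' = C * ip x v - S * ip x u" for x
    by (simp_all add: u'_def v'_def ip_add_right ip_diff_right ip_scaleR_right C_def S_def)
  have ipu': "ip u' x = C * ip u x + S * ip v x" and ipv': "ip v' x = C * ip v x - S * ip u x" for x
    by (simp_all add: u' v' ip_add_left ip_diff_left ip_scale_left)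
  have "smul (ip x u') u' + smul (ip x v') v'
      = smul ((C * ip x u + S * ip x v) * C - (C * ip x v - S * ip x u) * S) u
        + smul ((C * ip x u + S * ip x v) * S + (C * ip x v - S * ip x u) * C) v"
    unfolding ipu ipv by (simp add: u' v' scale_right_distrib scale_right_diff_distrib
        scale_left_distrib scale_left_diff_distrib)
  also have "(C * ip x u + S * ip x v) * C - (C * ip x v - S * ip x u) * S = (C * C + S * S) * ip x u"
    by (simp add: algebra_simps)
  also have "(C * ip x u + S * ip x v) * S + (C * ip x v - S * ip x u) * C = (C * C + S * S) * ip x v"
    by (simp add: algebra_simps)
  finally show "smul (ip x u') u' + smul (ip x v') v' = smul (ip x u) u + smul (ip x v) v"
    by (simp add: CS)
  have "ip u' u' + ip v' v' = (C * C + S * S) * ip u u + (C * C + S * S) * ip v v"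
    unfolding ipu ipv ipu' ipv' by (simp add: algebra_simps)
  then have "of_real ((norm u')\<^sup>2 + (norm v')\<^sup>2) = (of_real ((norm u)\<^sup>2 + (norm v)\<^sup>2) :: 'k)"
    by (simp only: CS mult_1 ip_self of_real_add)
  then show "(norm u')\<^sup>2 + (norm v')\<^sup>2 = (norm u)\<^sup>2 + (norm v)\<^sup>2"
    by (simp only: of_real_eq_iff)
qed

text \<open>
  Along the rotation by \<open>\<theta>\<close> from \<open>0\<close> to \<open>\<pi> / 2\<close>, the squared norm of the first vector moves
  continuously from that of \<open>u\<close> to that of \<open>v\<close>, and the sum of the two squared norms stays
  fixed. By the intermediate value theorem, every transfer in between occurs for some \<open>\<theta>\<close>.
\<close>

lemma transfer_norm_between_pair:
  assumes "0 \<le> \<delta>" "\<delta> \<le> (norm u)\<^sup>2 - (norm v)\<^sup>2"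
  obtains u' v' where "(norm u')\<^sup>2 = (norm u)\<^sup>2 - \<delta>" "(norm v')\<^sup>2 = (norm v)\<^sup>2 + \<delta>"
    and "\<And>x. smul (ip x u') u' + smul (ip x v') v' = smul (ip x u) u + smul (ip x v) v"
proof -
  let ?h = "\<lambda>\<theta>. (norm (cos \<theta> *\<^sub>R u + sin \<theta> *\<^sub>R v))\<^sup>2"
  have "\<exists>\<theta>. 0 \<le> \<theta> \<and> \<theta> \<le> pi / 2 \<and> ?h \<theta> = (norm u)\<^sup>2 - \<delta>"
    using assms by (intro IVT2') (auto intro!: continuous_intros)
  then obtain \<theta> where \<theta>: "?h \<theta> = (norm u)\<^sup>2 - \<delta>" by blast
  have "(cos \<theta>)\<^sup>2 + (sin \<theta>)\<^sup>2 = 1" by simp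
  note rot = rotate_pair[OF this, where u = u and v = v]
  show thesis
    using \<theta> rot(2) by (intro that[OF _ _ rot(1)]) auto
qed

text \<open>
  Sufficiency in the Schur-Horn theorem, for frame operators: the norms of \<open>h\<close> can be
  rearranged by transfers into \<open>a\<close>, and every transfer is realized by rotating two vectors
  of the sequence.
\<close>

lemma frame_operator_with_majorized_norms:
  fixes a :: "nat \<Rightarrow> real"
  assumes anti: "\<And>i j. 1 \<le> i \<Longrightarrow> i \<le> j \<Longrightarrow> j \<le> m \<Longrightarrow> a j \<le> a i"
    and partial: "\<And>k. k \<le> m \<Longrightarrow> (\<Sum>i=1..k. a i) \<le> (\<Sum>i=1..k. (norm (h i))\<^sup>2)"
    and total: "(\<Sum>i=1..m. a i) = (\<Sum>i=1..m. (norm (h i))\<^sup>2)"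
  obtains g where "\<And>i. i \<in> {1..m} \<Longrightarrow> (norm (g i))\<^sup>2 = a i"
    and "\<And>x. (\<Sum>i=1..m. smul (ip x (g i)) (g i)) = (\<Sum>i=1..m. smul (ip x (h i)) (h i))"
proof -
  define S where "S x = (\<Sum>i=1..m. smul (ip x (h i)) (h i))" for x
  define P where "P b \<longleftrightarrow> (\<exists>g. (\<forall>i\<in>{1..m}. (norm (g i))\<^sup>2 = b i) \<and>
      (\<forall>x. (\<Sum>i=1..m. smul (ip x (g i)) (g i)) = S x))" for b :: "nat \<Rightarrow> real"
  have "\<exists>b'. P b' \<and> (\<forall>i\<in>{1..m}. b' i = a i)"
  proof (rule majorized_reachable_by_transfers[OF _ anti partial total])
    show "P (\<lambda>i. (norm (h i))\<^sup>2)" by (auto simp: P_def S_def)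
    fix b i j \<delta>
    assume "P b" and i: "i \<in> {1..m}" and j: "j \<in> {1..m}" and ij: "i \<noteq> j"
      and \<delta>: "0 \<le> \<delta>" "\<delta> \<le> b i - b j"
    then obtain g where g: "\<And>i. i \<in> {1..m} \<Longrightarrow> (norm (g i))\<^sup>2 = b i"
      and gS: "\<And>x. (\<Sum>i=1..m. smul (ip x (g i)) (g i)) = S x"
      unfolding P_def by blast
    obtain u' v' where u': "(norm u')\<^sup>2 = b i - \<delta>" and v': "(norm v')\<^sup>2 = b j + \<delta>"
      and uv: "\<And>x. smul (ip x u') u' + smul (ip x v') v'
          = smul (ip x (g i)) (g i) + smul (ip x (g j)) (g j)"
      using transfer_norm_between_pair[of \<delta> "g i" "g j"] \<delta> g i j by metis
    define g' where "g' = g(i := u', j := v')"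
    have split: "(\<Sum>l=1..m. q l) = q i + q j + (\<Sum>l\<in>{1..m} - {i, j}. q l)" for q :: "nat \<Rightarrow> 'a"
    proof -
      have "(\<Sum>l=1..m. q l) = q i + (\<Sum>l\<in>{1..m} - {i}. q l)"
        using i by (intro sum.remove) auto
      also have "(\<Sum>l\<in>{1..m} - {i}. q l) = q j + (\<Sum>l\<in>{1..m} - {i} - {j}. q l)"
        using j ij by (intro sum.remove) auto
      also have "{1..m} - {i} - {j} = {1..m} - {i, j}" by auto
      finally show ?thesis by (simp add: add.assoc)
    qed
    have "(\<Sum>l=1..m. smul (ip x (g' l)) (g' l)) = S x" for x
    proof -
      have "(\<Sum>l\<in>{1..m} - {i, j}. smul (ip x (g' l)) (g' l))
          = (\<Sum>l\<in>{1..m} - {i, j}. smul (ip x (g l)) (g l))"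
        by (intro sum.cong) (auto simp: g'_def)
      then have "(\<Sum>l=1..m. smul (ip x (g' l)) (g' l)) = (\<Sum>l=1..m. smul (ip x (g l)) (g l))"
        unfolding split using uv[of x] ij by (simp add: g'_def)
      then show ?thesis using gS[of x] by simp
    qed
    moreover have "\<forall>l\<in>{1..m}. (norm (g' l))\<^sup>2 = (b(i := b i - \<delta>, j := b j + \<delta>)) l"
      using u' v' g ij by (auto simp: g'_def)
    ultimately show "P (b(i := b i - \<delta>, j := b j + \<delta>))"
      unfolding P_def by blast
  qed
  then show thesis unfolding P_def S_def using that by metis
qed

end

section \<open>Frame operators of finite and infinite sequences\<close>

lemma has_sum_finite_sum:
  fixes h :: "'b \<Rightarrow> 'c \<Rightarrow> 'd::topological_comm_monoid_add"
  assumes "\<And>l. l \<in> A \<Longrightarrow> (h l has_sum s l) B"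
  shows "((\<lambda>i. \<Sum>l\<in>A. h l i) has_sum (\<Sum>l\<in>A. s l)) B"
  using assms by (induction A rule: infinite_finite_induct) (auto intro!: has_sum_add)

lemma idx_enat [simp]: "idx (enat m) = {1..m}"
  by (auto simp: idx_def)

lemma idx_infinity [simp]: "idx \<infinity> = {1..}"
  by (auto simp: idx_def)

lemma frame_operator_enat:
  "frame_operator smul ip (enat m) h x = (\<Sum>i=1..m. smul (ip x (h i)) (h i))"
  by (simp add: frame_operator_def)

lemma sum_concat_seq:
  "(\<Sum>i=1..p+m. q (concat_seq p f g i)) = (\<Sum>i=1..p. q (f i)) + (\<Sum>i=1..m. q (g i))"
proof -
  have "(\<Sum>i=1..p+m. q (concat_seq p f g i))
      = (\<Sum>i=1..p. q (concat_seq p f g i)) + (\<Sum>i=p+1..p+m. q (concat_seq p f g i))"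
    by (rule sum.ub_add_nat) simp
  also have "(\<Sum>i=p+1..p+m. q (concat_seq p f g i)) = (\<Sum>i=1..m. q (g i))"
    by (rule sum.reindex_bij_witness[of _ "\<lambda>i. i + p" "\<lambda>i. i - p"])
      (auto simp: concat_seq_def)
  also have "(\<Sum>i=1..p. q (concat_seq p f g i)) = (\<Sum>i=1..p. q (f i))"
    by (intro sum.cong) (auto simp: concat_seq_def)
  finally show ?thesis .
qed

lemma idx_add_Diff: "idx (enat p + r) - {1..p} = (\<lambda>i. i + p) ` idx r"
proof (intro equalityI subsetI)
  fix x assume x: "x \<in> idx (enat p + r) - {1..p}"
  then have "p < x" by (auto simp: idx_def)
  then have "x - p \<in> idx r" "x = (x - p) + p" using x by (cases r; force simp: idx_def)+
  then show "x \<in> (\<lambda>i. i + p) ` idx r" by (rule rev_image_eqI)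
qed (cases r; auto simp: idx_def)

text \<open>
  Used with the energies of a completed sequence: what the given vectors do not
  contribute must come from the added ones.
\<close>

lemma has_sum_concat_seqD:
  fixes q :: "'a \<Rightarrow> real"
  assumes "((\<lambda>i. q (concat_seq p f g i)) has_sum s) (idx (enat p + r))"
  shows "((\<lambda>i. q (g i)) has_sum s - (\<Sum>i=1..p. q (f i))) (idx r)"
proof -
  have "((\<lambda>i. q (concat_seq p f g i)) has_sum (\<Sum>i=1..p. q (f i))) {1..p}"
    by (rule has_sum_finiteI) (auto simp: concat_seq_def intro!: sum.cong)
  moreover have "{1..p} \<subseteq> idx (enat p + r)"
    by (cases r) auto
  ultimately have "((\<lambda>i. q (concat_seq p f g i)) has_sum s - (\<Sum>i=1..p. q (f i)))
      ((\<lambda>i. i + p) ` idx r)"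
    unfolding idx_add_Diff [symmetric] using assms by (intro has_sum_Diff)
  then have "((\<lambda>i. q (concat_seq p f g (i + p))) has_sum s - (\<Sum>i=1..p. q (f i))) (idx r)"
    by (subst (asm) has_sum_reindex) (auto simp: o_def)
  then show ?thesis
    by (rule has_sum_cong[THEN iffD1, rotated]) (auto simp: concat_seq_def idx_def)
qed

context hilbert_space
begin

lemma linear_frame_operator:
  "Vector_Spaces.linear smul smul (frame_operator smul ip (enat m) h)"
  by unfold_locales
    (simp_all add: frame_operator_enat ip_add_left ip_scale_left scale_left_distrib
      sum.distrib scale_sum_right)

lemma frame_operator_self_adjoint:
  "ip (frame_operator smul ip (enat m) h x) y = ip x (frame_operator smul ip (enat m) h y)"
  by (simp add: frame_operator_enat ip_sum_left ip_sum_right ip_scale_left ip_scale_right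
      ip_conj[symmetric] mult.commute)

lemma ip_frame_operator_self:
  "ip (frame_operator smul ip (enat m) h x) x = of_real (\<Sum>i=1..m. (norm (ip x (h i)))\<^sup>2)"
  by (simp only: frame_operator_enat ip_sum_left ip_scale_left ip_mult_ip_commute of_real_sum)

text \<open>
  The frame operator is an infinite sum whose convergence is not part of its definition. It
  does converge at every \<open>x \<noteq> 0\<close>, because a divergent sum has the value \<open>0\<close>, which differs
  from \<open>c x\<close>.
\<close>

lemma tight_frame_quadratic_form:
  assumes "tight_frame smul ip m h"
  obtains c where "c > 0"
    and "\<And>x. ((\<lambda>i. (norm (ip x (h i)))\<^sup>2) has_sum c * (norm x)\<^sup>2) (idx m)"
proof -
  obtain c where c: "c > 0" and S: "\<And>x. frame_operator smul ip m h x = c *\<^sub>R x"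
    using assms by (auto simp: tight_frame_def)
  show thesis
  proof (rule that[OF c])
    fix x
    have "((\<lambda>i. smul (ip x (h i)) (h i)) has_sum c *\<^sub>R x) (idx m)"
    proof (cases "x = 0")
      case False
      then have "(\<Sum>\<^sub>\<infinity>i\<in>idx m. smul (ip x (h i)) (h i)) \<noteq> 0"
        using S[of x] c by (simp add: frame_operator_def)
      then have "(\<lambda>i. smul (ip x (h i)) (h i)) summable_on idx m"
        using infsum_not_exists by blast
      from has_sum_infsum[OF this] show ?thesis
        using S[of x] by (simp add: frame_operator_def)
    qed simp
    from has_sum_ip_left[OF this, of x]
    have "((\<lambda>i. of_real ((norm (ip x (h i)))\<^sup>2) :: 'k) has_sum of_real (c * (norm x)\<^sup>2)) (idx m)"
      by (simp only: ip_scale_left ip_mult_ip_commute ip_scaleR_left ip_self of_real_mult)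
    then show "((\<lambda>i. (norm (ip x (h i)))\<^sup>2) has_sum c * (norm x)\<^sup>2) (idx m)"
      by (simp only: has_sum_of_real_iff)
  qed
qed

lemma ip_diagonal_operator:
  assumes dim: "dim UNIV = n" "n \<ge> 1" and u: "orthonormal n u"
    and lin: "Vector_Spaces.linear smul smul T"
    and Tu: "\<And>l. l \<in> {1..n} \<Longrightarrow> T (u l) = nu l *\<^sub>R u l"
  shows "T x = (\<Sum>l=1..n. smul (ip x (u l)) (nu l *\<^sub>R u l))"
    and "ip (T x) x = of_real (\<Sum>l=1..n. nu l * (norm (ip x (u l)))\<^sup>2)"
proof -
  interpret T: Vector_Spaces.linear smul smul T by (rule lin)
  have "T x = (\<Sum>l\<in>{1..n}. smul (ip x (u l)) (T (u l)))"
    by (subst orthonormal_basis_expansion[OF dim u, of x]) (simp add: T.sum T.scale)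
  then show 1: "T x = (\<Sum>l=1..n. smul (ip x (u l)) (nu l *\<^sub>R u l))"
    by (simp add: Tu)
  have "ip (T x) x = (\<Sum>l=1..n. of_real (nu l) * (ip x (u l) * ip (u l) x))"
    by (simp add: 1 ip_sum_left ip_scale_left ip_scaleR_left mult.left_commute)
  then show "ip (T x) x = of_real (\<Sum>l=1..n. nu l * (norm (ip x (u l)))\<^sup>2)"
    by (simp only: ip_mult_ip_commute of_real_sum of_real_mult)
qed

text \<open>
  The hypothesis \<open>form\<close> says that the frame operator of \<open>g\<close> is diagonal in the orthonormal
  basis \<open>u\<close>, with eigenvalues \<open>mu\<close>. Stating this for the quadratic form covers finite and
  infinite index sets at once.
\<close>

context
  fixes n :: nat and u :: "nat \<Rightarrow> 'a" and mu :: "nat \<Rightarrow> real"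
    and I :: "nat set" and g :: "nat \<Rightarrow> 'a"
  assumes dim: "dim UNIV = n" "n \<ge> 1" and u: "orthonormal n u"
    and form: "\<And>x. ((\<lambda>i. (norm (ip x (g i)))\<^sup>2) has_sum
                  (\<Sum>l=1..n. mu l * (norm (ip x (u l)))\<^sup>2)) I"
begin

lemma form_on_basis:
  assumes k: "k \<in> {1..n}"
  shows "((\<lambda>i. (norm (ip (u k) (g i)))\<^sup>2) has_sum mu k) I"
proof -
  have "(\<Sum>l=1..n. mu l * (norm (ip (u k) (u l)))\<^sup>2) = (\<Sum>l=1..n. if l = k then mu l else 0)"
    using orthonormalD[OF u k] by (intro sum.cong) auto
  then show ?thesis using form[of "u k"] k by simp
qed

lemma form_nonneg: "k \<in> {1..n} \<Longrightarrow> mu k \<ge> 0"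
  by (rule has_sum_nonneg[OF form_on_basis]) auto

lemma norms_has_sum_trace: "((\<lambda>i. (norm (g i))\<^sup>2) has_sum (\<Sum>l=1..n. mu l)) I"
proof -
  have "((\<lambda>i. \<Sum>l=1..n. (norm (ip (u l) (g i)))\<^sup>2) has_sum (\<Sum>l=1..n. mu l)) I"
    by (intro has_sum_finite_sum form_on_basis)
  then show ?thesis
    by (simp only: Parseval[OF dim u] norm_ip_commute[of _ "u _"])
qed

text \<open>
  Necessity in the Schur-Horn theorem. The numbers \<open>q i l\<close> below satisfy
  \<open>\<parallel>g i\<parallel>\<^sup>2 = (\<Sum>l. mu l * q i l)\<close> and form a doubly substochastic matrix, so the left-hand side
  is a weighted sum of the eigenvalues with weights in \<open>[0, 1]\<close> of total at most \<open>card K\<close>.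
  The columns are bounded by evaluating the form at \<open>u l\<close>. A row sum \<open>t\<close> is bounded by
  evaluating the form at \<open>x = S\<^sup>+ (g i)\<close>, where \<open>S\<^sup>+\<close> inverts the frame operator on its range:
  the value there is \<open>t\<close>, whereas the term of \<open>g i\<close> alone already contributes \<open>t\<^sup>2\<close>.
\<close>

lemma norms_majorized:
  assumes anti: "\<And>i j. 1 \<le> i \<Longrightarrow> i \<le> j \<Longrightarrow> j \<le> n \<Longrightarrow> mu j \<le> mu i"
    and K: "finite K" "K \<subseteq> I" "card K \<in> {1..n}"
  shows "(\<Sum>i\<in>K. (norm (g i))\<^sup>2) \<le> (\<Sum>l=1..card K. mu l)"
proof -
  define q where "q i l = (norm (ip (g i) (u l)))\<^sup>2 / mu l" for i l
  \<comment> \<open>If \<open>mu l = 0\<close>, every \<open>g i\<close> with \<open>i \<in> I\<close> is orthogonal to \<open>u l\<close>, and division by \<open>0\<close> gives \<open>q i l = 0\<close>,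
      which is the value that the pseudo-inverse requires.\<close>
  have q0: "0 \<le> q i l" if "l \<in> {1..n}" for i l
    using form_nonneg[OF that] by (simp add: q_def)
  have column_le: "(\<Sum>i\<in>A. (norm (ip (g i) (u l)))\<^sup>2) \<le> mu l"
    if "l \<in> {1..n}" "finite A" "A \<subseteq> I" for A l
    using finite_sum_le_has_sum[OF form_on_basis[OF that(1)] that(2,3)]
    by (simp add: norm_ip_commute[of "u l"])
  have column: "(\<Sum>i\<in>K. q i l) \<le> 1" if l: "l \<in> {1..n}" for l
  proof -
    have "(\<Sum>i\<in>K. q i l) \<le> mu l / mu l"
      unfolding q_def sum_divide_distrib [symmetric]
      using column_le[OF l K(1,2)] form_nonneg[OF l] by (rule divide_right_mono)
    also have "\<dots> \<le> 1" by simp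
    finally show ?thesis .
  qed
  have row: "(\<Sum>l=1..n. q i l) \<le> 1" if i: "i \<in> I" for i
  proof -
    define t where "t = (\<Sum>l=1..n. q i l)"
    define x where "x = (\<Sum>l\<in>{1..n}. smul (ip (g i) (u l) / of_real (mu l)) (u l))"
    have "ip x (g i) = (\<Sum>l=1..n. ip (g i) (u l) * ip (u l) (g i) / of_real (mu l))"
      by (simp add: x_def ip_sum_left ip_scale_left)
    also have "\<dots> = of_real t"
      by (simp only: ip_mult_ip_commute q_def t_def of_real_sum of_real_divide)
    finally have "(norm (ip x (g i)))\<^sup>2 = t\<^sup>2" by simp
    moreover have "(norm (ip x (g i)))\<^sup>2 \<le> (\<Sum>l=1..n. mu l * (norm (ip x (u l)))\<^sup>2)"
      using finite_sum_le_has_sum[OF form[of x], of "{i}"] i by simp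
    moreover have "mu l * (norm (ip x (u l)))\<^sup>2 = q i l" if l: "l \<in> {1..n}" for l
    proof -
      have "ip x (u l) = ip (g i) (u l) / of_real (mu l)"
        unfolding x_def by (rule ip_orthonormal_expansion[OF u subset_refl l])
      then show ?thesis
        by (simp add: q_def norm_divide power_divide power2_eq_square)
    qed
    ultimately have "t * t \<le> 1 * t" by (simp add: t_def power2_eq_square)
    moreover have "0 \<le> t" unfolding t_def by (intro sum_nonneg q0)
    ultimately have "t \<le> 1"
      by (metis mult_right_le_imp_le linorder_le_less_linear order_trans zero_le_one)
    then show ?thesis by (simp add: t_def)
  qed
  have entry: "(norm (ip (g i) (u l)))\<^sup>2 = mu l * q i l" if i: "i \<in> I" and l: "l \<in> {1..n}" for i l
    using column_le[OF l, of "{i}"] i by (cases "mu l = 0") (auto simp: q_def)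
  have "(\<Sum>i\<in>K. (norm (g i))\<^sup>2) = (\<Sum>i\<in>K. \<Sum>l=1..n. mu l * q i l)"
    using K(2) by (intro sum.cong refl) (auto simp: Parseval[OF dim u] entry intro!: sum.cong)
  also have "\<dots> = (\<Sum>l=1..n. mu l * (\<Sum>i\<in>K. q i l))"
    by (subst sum.swap) (simp add: sum_distrib_left)
  also have "\<dots> \<le> (\<Sum>l=1..card K. mu l)"
  proof (rule weighted_sum_le_sum_largest[where mu = mu and n = n])
    have "(\<Sum>l=1..n. \<Sum>i\<in>K. q i l) = (\<Sum>i\<in>K. \<Sum>l=1..n. q i l)" by (rule sum.swap)
    also have "\<dots> \<le> (\<Sum>i\<in>K. 1)" using K(2) by (intro sum_mono row) auto
    finally show "(\<Sum>l=1..n. \<Sum>i\<in>K. q i l) \<le> real (card K)" by simp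
  qed (use K(3) anti form_nonneg column in \<open>auto intro!: sum_nonneg q0\<close>)
  finally show ?thesis .
qed

end

end

section \<open>Tight completions with prescribed norms\<close>

lemma c_seq_le_iff:
  "c_seq n lam a k \<le> x \<longleftrightarrow>
    lam 1 \<le> x \<and> (\<forall>j\<in>{1..k}. (\<Sum>i=1..j. a i + lam (n - i + 1)) \<le> real j * x)"
proof (induction k)
  case (Suc k)
  have "(\<Sum>i=1..Suc k. a i + lam (n - i + 1)) / real (Suc k) \<le> x
      \<longleftrightarrow> (\<Sum>i=1..Suc k. a i + lam (n - i + 1)) \<le> real (Suc k) * x"
    by (simp add: pos_divide_le_eq mult.commute del: sum.cl_ivl_Suc of_nat_Suc)
  then show ?case
    using Suc by (auto simp: atLeastAtMostSuc_conv simp del: sum.cl_ivl_Suc of_nat_Suc)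
qed simp

lemma sum_rev_index:
  "(\<Sum>i=1..n. q (n - i + 1)) = (\<Sum>i=1..n. q i)" for q :: "nat \<Rightarrow> 'a::comm_monoid_add"
  by (rule sum.reindex_bij_witness[of _ "\<lambda>i. n - i + 1" "\<lambda>i. n - i + 1"]) auto

text \<open>
  The \<open>n - k\<close> eigenvalues that do not occur in the last term of \<open>c_seq n lam a k\<close> are bounded
  by \<open>lam 1\<close>, hence by \<open>c_seq n lam a k\<close>. This is why, for \<open>k < n\<close>, the inequality that
  characterizes completability can only hold as an equation.
\<close>

lemma c_seq_lower_bound:
  assumes k: "1 \<le> k" "k \<le> n" and lam: "\<And>i. i \<in> {1..n} \<Longrightarrow> lam i \<le> lam 1"
  shows "((\<Sum>i=1..k. a i) + (\<Sum>i=1..n. lam i)) / real n \<le> c_seq n lam a k"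
proof -
  define x where "x = c_seq n lam a k"
  have x: "lam 1 \<le> x" "(\<Sum>i=1..k. a i + lam (n - i + 1)) \<le> real k * x"
    using c_seq_le_iff[of n lam a k x] k by (auto simp: x_def)
  have "(\<Sum>i=k+1..n. lam (n - i + 1)) \<le> (\<Sum>i=k+1..n. x)"
  proof (rule sum_mono)
    fix i assume "i \<in> {k+1..n}"
    then have "n - i + 1 \<in> {1..n}" by auto
    then show "lam (n - i + 1) \<le> x" using lam x(1) order_trans by blast
  qed
  moreover have "(\<Sum>i=1..n. lam i) = (\<Sum>i=1..k. lam (n - i + 1)) + (\<Sum>i=k+1..n. lam (n - i + 1))"
    unfolding sum_rev_index[of lam n, symmetric]
    using k sum.ub_add_nat[of 1 k "\<lambda>i. lam (n - i + 1)" "n - k"] by simp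
  ultimately have "(\<Sum>i=1..k. a i) + (\<Sum>i=1..n. lam i) \<le> real k * x + real (n - k) * x"
    using x(2) by (simp add: sum.distrib)
  also have "\<dots> = real n * x" using k by (simp flip: distrib_right of_nat_add)
  finally show ?thesis using k by (simp add: x_def divide_le_eq mult.commute)
qed

context hilbert_space
begin

text \<open>
  The vectors to be added must have the frame operator \<open>c I - S\<close>, which is diagonal in the
  eigenbasis with entries \<open>mu l = c - nu l\<close>. The vectors \<open>sqrt (mu l) u l\<close>, cut off or padded
  with zeros to length \<open>m\<close>, have this frame operator and only the wrong norms.
\<close>

lemma completable_enat_if_majorized:
  assumes dim: "dim UNIV = n" "n \<ge> 1" and u: "orthonormal n u"
    and Tu: "\<And>l. l \<in> {1..n} \<Longrightarrow> frame_operator smul ip (enat p) f (u l) = nu l *\<^sub>R u l"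
    and a_nonneg: "\<And>i. 1 \<le> i \<Longrightarrow> 0 \<le> a i"
    and anti: "\<And>i j. 1 \<le> i \<Longrightarrow> i \<le> j \<Longrightarrow> a j \<le> a i"
    and c: "c > 0" "\<And>l. l \<in> {1..n} \<Longrightarrow> nu l \<le> c"
    and partial: "\<And>k. k \<le> m \<Longrightarrow> k \<le> n \<Longrightarrow> (\<Sum>i=1..k. a i) \<le> (\<Sum>l=1..k. c - nu l)"
    and total: "(\<Sum>i=1..m. a i) = (\<Sum>l=1..n. c - nu l)"
  shows "completable smul ip p f a (enat m)"
proof -
  let ?T = "frame_operator smul ip (enat p) f"
  define mu where "mu l = c - nu l" for l
  have mu0: "mu l \<ge> 0" if "l \<in> {1..n}" for l using c(2)[OF that] by (simp add: mu_def)
  \<comment> \<open>If fewer than \<open>n\<close> vectors are added, cutting off loses nothing: the first \<open>m\<close> entries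
      \<open>mu l\<close> already exhaust the trace.\<close>
  have mu_tail: "mu l = 0" if l: "l \<in> {1..n}" "m < l" for l
  proof -
    have "(\<Sum>i\<in>{1..n} - {1..m}. mu i) = (\<Sum>i=1..n. mu i) - (\<Sum>i=1..m. mu i)"
      using l by (intro sum_diff) auto
    also have "\<dots> \<le> 0" using partial[of m] total l by (simp add: mu_def)
    finally have "(\<Sum>i\<in>{1..n} - {1..m}. mu i) = 0"
      using mu0 by (intro antisym sum_nonneg) auto
    then show ?thesis
      using sum_nonneg_eq_0_iff[of "{1..n} - {1..m}" mu] mu0 l by auto
  qed
  define h where "h i = (if i \<le> n then sqrt (mu i) *\<^sub>R u i else 0)" for i
  have norm_h: "(norm (h i))\<^sup>2 = (if i \<le> n then mu i else 0)" if "1 \<le> i" for i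
  proof (cases "i \<le> n")
    case True
    then have "norm (u i) = 1" using orthonormalD[OF u, of i i] that by (intro norm_eq_1_if) auto
    then show ?thesis using True mu0[of i] that by (simp add: h_def power_mult_distrib)
  qed (simp add: h_def)
  have partial_h: "(\<Sum>i=1..k. (norm (h i))\<^sup>2) = (\<Sum>l=1..min n k. mu l)" for k
    by (rule sum.mono_neutral_cong) (auto simp: norm_h)
  have full: "(\<Sum>l=1..min n k. mu l) = (\<Sum>l=1..n. mu l)" if "min n m \<le> k" for k
    using that mu_tail by (intro sum.mono_neutral_left) auto
  obtain g where g: "\<And>i. i \<in> {1..m} \<Longrightarrow> (norm (g i))\<^sup>2 = a i"
    and gh: "\<And>x. (\<Sum>i=1..m. smul (ip x (g i)) (g i)) = (\<Sum>i=1..m. smul (ip x (h i)) (h i))"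
  proof (rule frame_operator_with_majorized_norms[of m a h])
    show "a j \<le> a i" if "1 \<le> i" "i \<le> j" for i j using anti that .
    show "(\<Sum>i=1..m. a i) = (\<Sum>i=1..m. (norm (h i))\<^sup>2)"
      using total full[of m] partial_h[of m] by (simp add: mu_def)
    show "(\<Sum>i=1..k. a i) \<le> (\<Sum>i=1..k. (norm (h i))\<^sup>2)" if k: "k \<le> m" for k
    proof (cases "k \<le> n")
      case True
      then show ?thesis using partial[OF k] partial_h[of k] by (simp add: mu_def min_def)
    next
      case False
      have "(\<Sum>i=1..k. a i) \<le> (\<Sum>i=1..m. a i)"
        using k a_nonneg by (intro sum_mono2) auto
      then show ?thesis using False total partial_h[of k] by (simp add: mu_def min_def)
    qed
  qed blast
  have diag: "(\<Sum>i=1..m. smul (ip x (h i)) (h i)) = c *\<^sub>R x - ?T x" for x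
  proof -
    have "smul (ip x (h i)) (h i) = smul (ip x (u i)) (mu i *\<^sub>R u i)" if "i \<in> {1..n}" for i
    proof -
      have "smul (ip x (h i)) (h i) = smul (of_real (sqrt (mu i) * sqrt (mu i)) * ip x (u i)) (u i)"
        using that by (simp add: h_def ip_scale_right mult_ac del: real_sqrt_mult_self flip: scale_of_real)
      also have "sqrt (mu i) * sqrt (mu i) = mu i" using mu0[OF that] by simp
      finally show ?thesis by (simp add: mult.commute flip: scale_of_real)
    qed
    then have "(\<Sum>i=1..m. smul (ip x (h i)) (h i)) = (\<Sum>i=1..n. smul (ip x (u i)) (mu i *\<^sub>R u i))"
      using mu_tail by (intro sum.mono_neutral_cong) (auto simp: h_def)
    also have "\<dots> = c *\<^sub>R (\<Sum>i\<in>{1..n}. smul (ip x (u i)) (u i))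
        - (\<Sum>i=1..n. smul (ip x (u i)) (nu i *\<^sub>R u i))"
      by (simp add: mu_def scale_sum_right sum_subtractf scale_left_diff_distrib
          scale_right_diff_distrib algebra_simps flip: scale_of_real)
    finally show ?thesis
      using orthonormal_basis_expansion[OF dim u, of x]
        ip_diagonal_operator(1)[OF dim u linear_frame_operator Tu, of x] by simp
  qed
  have S: "frame_operator smul ip (enat (p + m)) (concat_seq p f g) x = c *\<^sub>R x" for x
    using sum_concat_seq[of "\<lambda>v. smul (ip x v) v" p f g m] gh[of x] diag[of x]
    by (simp add: frame_operator_enat)
  have energy: "(\<Sum>i=1..p+m. (norm (ip x (concat_seq p f g i)))\<^sup>2) = c * (norm x)\<^sup>2" for x
  proof -
    have "of_real (\<Sum>i=1..p+m. (norm (ip x (concat_seq p f g i)))\<^sup>2) = (of_real (c * (norm x)\<^sup>2) :: 'k)"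
      by (simp only: ip_frame_operator_self[symmetric] S ip_scaleR_left ip_self of_real_mult)
    then show ?thesis by (simp only: of_real_eq_iff)
  qed
  have energy_g: "(\<Sum>i=1..m. (norm (ip x (g i)))\<^sup>2) \<le> c * (norm x)\<^sup>2" for x
    using energy[of x] sum_concat_seq[of "\<lambda>v. (norm (ip x v))\<^sup>2" p f g m]
      sum_nonneg[of "{1..p}" "\<lambda>i. (norm (ip x (f i)))\<^sup>2"] by simp
  have "bessel ip (enat (p + m)) (concat_seq p f g)" "bessel ip (enat m) g"
    using c(1) energy energy_g by (auto simp: bessel_def intro!: exI[of _ c])
  then show ?thesis
    unfolding completable_def tight_frame_def using g S c(1) by (intro exI[of _ g]) auto
qed

text \<open>
  Tightness says that the energies of the given and of the added vectors sum to
  \<open>c \<parallel>x\<parallel>\<^sup>2\<close>. Subtracting the energy of the given ones, which is diagonal in their eigenbasis,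
  leaves a diagonal form for the added ones, to which the majorization inequalities apply.
\<close>

lemma completable_imp_majorized:
  assumes dim: "dim UNIV = n" "n \<ge> 1" and u: "orthonormal n u"
    and Tu: "\<And>l. l \<in> {1..n} \<Longrightarrow> frame_operator smul ip (enat p) f (u l) = nu l *\<^sub>R u l"
    and mono: "\<And>i j. 1 \<le> i \<Longrightarrow> i \<le> j \<Longrightarrow> j \<le> n \<Longrightarrow> nu i \<le> nu j"
    and compl: "completable smul ip p f a r"
  obtains c where "\<And>l. l \<in> {1..n} \<Longrightarrow> nu l \<le> c"
    and "(a has_sum (\<Sum>l=1..n. c - nu l)) (idx r)"
    and "\<And>k. k \<in> {1..n} \<Longrightarrow> enat k \<le> r \<Longrightarrow> (\<Sum>i=1..k. a i) \<le> (\<Sum>l=1..k. c - nu l)"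
proof -
  obtain g where g: "\<And>i. i \<in> idx r \<Longrightarrow> (norm (g i))\<^sup>2 = a i"
    and tight: "tight_frame smul ip (enat p + r) (concat_seq p f g)"
    using compl by (auto simp: completable_def)
  obtain c where
    "((\<lambda>i. (norm (ip x (concat_seq p f g i)))\<^sup>2) has_sum c * (norm x)\<^sup>2) (idx (enat p + r))" for x
    using tight_frame_quadratic_form[OF tight] by metis
  then have 1: "((\<lambda>i. (norm (ip x (g i)))\<^sup>2) has_sum c * (norm x)\<^sup>2
      - (\<Sum>i=1..p. (norm (ip x (f i)))\<^sup>2)) (idx r)" for x
    by (rule has_sum_concat_seqD)
  have 2: "c * (norm x)\<^sup>2 - (\<Sum>i=1..p. (norm (ip x (f i)))\<^sup>2)
      = (\<Sum>l=1..n. (c - nu l) * (norm (ip x (u l)))\<^sup>2)" for x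
  proof -
    have "of_real (\<Sum>i=1..p. (norm (ip x (f i)))\<^sup>2)
        = (of_real (\<Sum>l=1..n. nu l * (norm (ip x (u l)))\<^sup>2) :: 'k)"
      using ip_diagonal_operator(2)[OF dim u linear_frame_operator Tu, of x]
      by (simp only: ip_frame_operator_self)
    then have "(\<Sum>i=1..p. (norm (ip x (f i)))\<^sup>2) = (\<Sum>l=1..n. nu l * (norm (ip x (u l)))\<^sup>2)"
      by (simp only: of_real_eq_iff)
    then show ?thesis
      by (simp add: Parseval[OF dim u] sum_distrib_left left_diff_distrib sum_subtractf)
  qed
  note form = 1[unfolded 2]
  show thesis
  proof (rule that[of c])
    show "nu l \<le> c" if "l \<in> {1..n}" for l
      using form_nonneg[OF dim u form that] by simp
    show "(a has_sum (\<Sum>l=1..n. c - nu l)) (idx r)"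
      using norms_has_sum_trace[OF dim u form] g by (subst has_sum_cong[of _ _ "\<lambda>i. (norm (g i))\<^sup>2"]) auto
    fix k assume k: "k \<in> {1..n}" "enat k \<le> r"
    have K: "{1..k} \<subseteq> idx r"
    proof
      fix i assume "i \<in> {1..k}"
      then have "enat i \<le> enat k" by simp
      then show "i \<in> idx r" using order_trans[OF _ k(2)] \<open>i \<in> {1..k}\<close> by (simp add: idx_def)
    qed
    have "(\<Sum>i=1..k. a i) = (\<Sum>i\<in>{1..k}. (norm (g i))\<^sup>2)"
      using K g by (intro sum.cong) auto
    also have "\<dots> \<le> (\<Sum>l=1..card {1..k}. c - nu l)"
      by (rule norms_majorized[OF dim u form]) (use mono k K in auto)
    finally show "(\<Sum>i=1..k. a i) \<le> (\<Sum>l=1..k. c - nu l)" by simp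
  qed
qed

end

section \<open>The minimal number of added vectors\<close>

context hilbert_space
begin

context
  fixes n p :: nat and f :: "nat \<Rightarrow> 'a" and lam a :: "nat \<Rightarrow> real" and \<alpha> :: real
  assumes dim: "dim UNIV = n" "n \<ge> 1"
    and eig: "ordered_eigenvalues smul (frame_operator smul ip (enat p) f) n lam"
    and trace: "of_real \<alpha> = op_trace smul (frame_operator smul ip (enat p) f)"
    and a_pos: "\<And>i. 1 \<le> i \<Longrightarrow> 0 < a i"
    and a_anti: "\<And>i j. 1 \<le> i \<Longrightarrow> i \<le> j \<Longrightarrow> a j \<le> a i"
begin

lemma lam_antimono: "1 \<le> i \<Longrightarrow> i \<le> j \<Longrightarrow> j \<le> n \<Longrightarrow> lam j \<le> lam i"
  using eig by (simp add: ordered_eigenvalues_def)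

text \<open>
  The eigenvectors are listed by increasing eigenvalue, so that the eigenvalues \<open>c - lam\<close> of
  the frame operator of the added vectors come out in nonincreasing order, as does \<open>a\<close>.
\<close>

lemma increasing_eigenbasis:
  obtains u where "orthonormal n u"
    and "\<And>l. l \<in> {1..n} \<Longrightarrow> frame_operator smul ip (enat p) f (u l) = lam (n - l + 1) *\<^sub>R u l"
proof -
  let ?T = "frame_operator smul ip (enat p) f"
  have "card {i\<in>{1..n}. of_real (lam (n - i + 1)) = \<mu>} \<le> dim {v. ?T v = smul \<mu> v}" for \<mu>
  proof -
    have "bij_betw (\<lambda>i. n - i + 1) {i\<in>{1..n}. of_real (lam (n - i + 1)) = \<mu>}
        {i\<in>{1..n}. of_real (lam i) = \<mu>}"
      by (rule bij_betw_byWitness[where f' = "\<lambda>i. n - i + 1"]) auto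
    then show ?thesis
      using eig by (simp add: ordered_eigenvalues_def bij_betw_same_card)
  qed
  from orthonormal_eigenvectors[OF linear_frame_operator frame_operator_self_adjoint this order_refl]
  show thesis using that by blast
qed

lemma alpha_eq_sum_eigenvalues: "\<alpha> = (\<Sum>i=1..n. lam i)"
proof -
  obtain u where u: "orthonormal n u"
    and Tu: "\<And>l. l \<in> {1..n} \<Longrightarrow> frame_operator smul ip (enat p) f (u l) = lam (n - l + 1) *\<^sub>R u l"
    using increasing_eigenbasis by blast
  have "of_real \<alpha> = (\<Sum>l\<in>{1..n}. ip (frame_operator smul ip (enat p) f (u l)) (u l))"
    unfolding trace by (rule trace_orthonormal_basis[OF dim u linear_frame_operator])
  also have "\<dots> = (\<Sum>l\<in>{1..n}. of_real (lam (n - l + 1)))"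
    using orthonormalD[OF u] by (intro sum.cong) (auto simp: Tu ip_scaleR_left)
  also have "\<dots> = of_real (\<Sum>l=1..n. lam (n - l + 1))" by simp
  finally show ?thesis
    by (simp only: of_real_eq_iff sum_rev_index)
qed

lemma eigenvalue_nonneg: "l \<in> {1..n} \<Longrightarrow> 0 \<le> lam l"
proof -
  assume l: "l \<in> {1..n}"
  obtain u where u: "orthonormal n u"
    and Tu: "\<And>l. l \<in> {1..n} \<Longrightarrow> frame_operator smul ip (enat p) f (u l) = lam (n - l + 1) *\<^sub>R u l"
    using increasing_eigenbasis by blast
  define k where "k = n - l + 1"
  have k: "k \<in> {1..n}" "n - k + 1 = l" using l by (auto simp: k_def)
  have "ip (frame_operator smul ip (enat p) f (u k)) (u k) = of_real (lam l)"
    using Tu[OF k(1)] k orthonormalD[OF u k(1) k(1)] by (simp add: ip_scaleR_left)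
  then have "of_real (lam l) = (of_real (\<Sum>i=1..p. (norm (ip (u k) (f i)))\<^sup>2) :: 'k)"
    by (simp only: ip_frame_operator_self)
  then have "lam l = (\<Sum>i=1..p. (norm (ip (u k) (f i)))\<^sup>2)" by (simp only: of_real_eq_iff)
  then show ?thesis by (simp add: sum_nonneg)
qed

lemma sum_complement: "(\<Sum>l=1..n. c - lam (n - l + 1)) = real n * c - \<alpha>"
  using sum_rev_index[of lam n] by (simp add: alpha_eq_sum_eigenvalues sum_subtractf)

lemma completable_imp_c_seq_le:
  assumes compl: "completable smul ip p f a r"
    and k: "k \<le> n" "enat k \<le> r"
  obtains s where "(a has_sum s) (idx r)" "c_seq n lam a k \<le> (s + \<alpha>) / real n"
proof -
  obtain u where u: "orthonormal n u"
    and Tu: "\<And>l. l \<in> {1..n} \<Longrightarrow> frame_operator smul ip (enat p) f (u l) = lam (n - l + 1) *\<^sub>R u l"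
    using increasing_eigenbasis by blast
  have mono: "lam (n - i + 1) \<le> lam (n - j + 1)" if "1 \<le> i" "i \<le> j" "j \<le> n" for i j
    using that by (intro lam_antimono) auto
  obtain c where lam_le: "\<And>l. l \<in> {1..n} \<Longrightarrow> lam (n - l + 1) \<le> c"
    and sum: "(a has_sum (\<Sum>l=1..n. c - lam (n - l + 1))) (idx r)"
    and partial: "\<And>k. k \<in> {1..n} \<Longrightarrow> enat k \<le> r \<Longrightarrow>
          (\<Sum>i=1..k. a i) \<le> (\<Sum>l=1..k. c - lam (n - l + 1))"
    using completable_imp_majorized[OF dim u Tu mono compl] by blast
  have "c_seq n lam a k \<le> c"
    unfolding c_seq_le_iff
  proof (intro conjI ballI)
    show "lam 1 \<le> c" using lam_le[of n] dim(2) by simp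
    fix j assume j: "j \<in> {1..k}"
    then have "enat j \<le> r" using k(2) by (auto elim: order_trans[rotated])
    then show "(\<Sum>i=1..j. a i + lam (n - i + 1)) \<le> real j * c"
      using partial[of j] j k by (simp add: sum.distrib sum_subtractf)
  qed
  also have "c = ((\<Sum>l=1..n. c - lam (n - l + 1)) + \<alpha>) / real n"
    unfolding sum_complement using dim(2) by simp
  finally show thesis using sum by (rule that[rotated])
qed

text \<open>
  The constant of a tight completion is determined by the trace: it is the right-hand side.
  The condition \<open>c_seq n lam a (min n m) \<le> c\<close> unfolds to \<open>lam 1 \<le> c\<close>, which says that
  \<open>c I - S\<close> is positive semidefinite, and to the majorization inequalities between \<open>a\<close> and
  the eigenvalues of \<open>c I - S\<close>.
\<close>

theorem completable_enat_iff:
  assumes m: "m \<ge> 1"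
  shows "completable smul ip p f a (enat m) \<longleftrightarrow>
    c_seq n lam a (min n m) \<le> ((\<Sum>i=1..m. a i) + \<alpha>) / real n"
proof
  assume "completable smul ip p f a (enat m)"
  then obtain s where s: "(a has_sum s) (idx (enat m))"
    and le: "c_seq n lam a (min n m) \<le> (s + \<alpha>) / real n"
    by (elim completable_imp_c_seq_le[of "enat m" "min n m"]) auto
  have "s = (\<Sum>i=1..m. a i)"
    using infsumI[OF s] by simp
  then show "c_seq n lam a (min n m) \<le> ((\<Sum>i=1..m. a i) + \<alpha>) / real n" using le by simp
next
  define c where "c = ((\<Sum>i=1..m. a i) + \<alpha>) / real n"
  assume "c_seq n lam a (min n m) \<le> ((\<Sum>i=1..m. a i) + \<alpha>) / real n"
  then have c: "lam 1 \<le> c"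
    and partial: "\<And>j. j \<in> {1..min n m} \<Longrightarrow> (\<Sum>i=1..j. a i + lam (n - i + 1)) \<le> real j * c"
    unfolding c_def [symmetric] c_seq_le_iff by auto
  obtain u where u: "orthonormal n u"
    and Tu: "\<And>l. l \<in> {1..n} \<Longrightarrow> frame_operator smul ip (enat p) f (u l) = lam (n - l + 1) *\<^sub>R u l"
    using increasing_eigenbasis by blast
  show "completable smul ip p f a (enat m)"
  proof (rule completable_enat_if_majorized[OF dim u Tu])
    show "0 \<le> a i" if "1 \<le> i" for i using a_pos[OF that] by simp
    show "a j \<le> a i" if "1 \<le> i" "i \<le> j" for i j using a_anti that .
    have "0 < (\<Sum>i=1..m. a i)" using m a_pos by (intro sum_pos) auto
    moreover have "0 \<le> \<alpha>" unfolding alpha_eq_sum_eigenvalues by (intro sum_nonneg eigenvalue_nonneg)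
    ultimately show "0 < c" using dim(2) by (simp add: c_def)
    show "lam (n - l + 1) \<le> c" if "l \<in> {1..n}" for l
    proof -
      have "n - l + 1 \<le> n" using that by auto
      then show ?thesis using lam_antimono[of 1 "n - l + 1"] c by simp
    qed
    show "(\<Sum>i=1..m. a i) = (\<Sum>l=1..n. c - lam (n - l + 1))"
      unfolding sum_complement using dim(2) by (simp add: c_def)
    show "(\<Sum>i=1..k. a i) \<le> (\<Sum>l=1..k. c - lam (n - l + 1))" if "k \<le> m" "k \<le> n" for k
      using partial[of k] that by (cases "k = 0") (auto simp: sum.distrib sum_subtractf)
  qed
qed

lemma completable_infinity_imp:
  assumes "completable smul ip p f a \<infinity>"
  obtains s where "(\<lambda>i. a (Suc i)) sums s" "c_seq n lam a n \<le> (s + \<alpha>) / real n"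
proof -
  obtain s where s: "(a has_sum s) {1..}" and le: "c_seq n lam a n \<le> (s + \<alpha>) / real n"
    using completable_imp_c_seq_le[OF assms, of n] by auto
  have "{1..} = range Suc" by (auto simp: image_iff) (metis Suc_le_D)
  then have "((\<lambda>i. a (Suc i)) has_sum s) UNIV"
    using s has_sum_reindex[of Suc UNIV a s] by (simp add: o_def)
  then have "(\<lambda>i. a (Suc i)) sums s" by (rule has_sum_imp_sums)
  then show thesis using le that by blast
qed

end

end

theorem theoremB:
  fixes smul :: "'k::real_or_complex \<Rightarrow> 'a::banach \<Rightarrow> 'a"
    and ip :: "'a \<Rightarrow> 'a \<Rightarrow> 'k"
    and f :: "nat \<Rightarrow> 'a"
    and lam a c avg :: "nat \<Rightarrow> real"
    and \<alpha> :: real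
    and n p :: nat
    and r0 :: enat
  assumes "hilbert_space smul ip"
    and "n \<ge> 1" and "vector_space.dim smul (UNIV :: 'a set) = n"
    and "p \<ge> 1"
    and "ordered_eigenvalues smul (frame_operator smul ip (enat p) f) n lam"
    and "of_real \<alpha> = op_trace smul (frame_operator smul ip (enat p) f)"
    and "\<forall>i\<ge>1. a i > 0"
    and "\<forall>i j. 1 \<le> i \<and> i \<le> j \<longrightarrow> a j \<le> a i"
    and "c = c_seq n lam a"
    and "avg = (\<lambda>k. ((\<Sum>i=1..k. a i) + \<alpha>) / real n)"
    and "\<exists>r\<ge>1. completable smul ip p f a r"
    and "r0 = (LEAST r. r \<ge> 1 \<and> completable smul ip p f a r)"
  shows
    "((r0 < enat n \<longleftrightarrow> (\<exists>k\<in>{1..n-1}. c k = avg k)) \<and>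
      (\<forall>k\<in>{1..n-1}. r0 = enat k \<longrightarrow> c k = avg k)) \<and>
     (enat n \<le> r0 \<and> r0 < \<infinity> \<longleftrightarrow>
      (\<forall>k\<in>{1..n-1}. c k \<noteq> avg k) \<and>
      (\<exists>m\<ge>1. r0 = enat m \<and> c n \<le> avg m \<and> (\<forall>j\<ge>1. c n \<le> avg j \<longrightarrow> m \<le> j))) \<and>
     (r0 = \<infinity> \<longleftrightarrow>
      (\<forall>k\<in>{1..n-1}. c k \<noteq> avg k) \<and>
      ereal (c n) = ((\<Sum>i. ereal (a (Suc i))) + ereal \<alpha>) / ereal (real n))"
proof -
  interpret hilbert_space smul ip by fact
  have a_pos: "\<And>i. 1 \<le> i \<Longrightarrow> 0 < a i" and a_anti: "\<And>i j. 1 \<le> i \<Longrightarrow> i \<le> j \<Longrightarrow> a j \<le> a i"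
    using assms by auto
  note setting = assms(3,2,5,6) a_pos a_anti
  let ?C = "completable smul ip p f a"
  let ?S = "\<Sum>i. ereal (a (Suc i))"
  have fin: "?C (enat m) \<longleftrightarrow> c (min n m) \<le> avg m" if "m \<ge> 1" for m
    using completable_enat_iff[OF setting that] assms(9,10) by simp
  have inf: "\<exists>s. (\<lambda>i. a (Suc i)) sums s \<and> c n \<le> (s + \<alpha>) / real n" if "?C \<infinity>"
    using completable_infinity_imp[OF setting that] assms(9) by blast
  have low: "avg k \<le> c k" if "k \<in> {1..n}" for k
    using c_seq_lower_bound[of k n lam a] that lam_antimono[OF setting, where i = 1]
      alpha_eq_sum_eigenvalues[OF setting] assms(9,10) by auto
  \<comment> \<open>Below \<open>n\<close>, the inequality of \<open>fin\<close> meets the opposite one, \<open>low\<close>.\<close>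
  have small: "?C (enat k) \<longleftrightarrow> c k = avg k" if "k \<in> {1..n-1}" for k
    using fin[of k] low[of k] that by (auto simp: min_def)
  have c_mono: "c j \<le> c n" if "j \<le> n" for j
    unfolding assms(9) using that
    by (intro monoD[of "c_seq n lam a"]) (simp_all add: mono_iff_le_Suc)
  have avg_Suc: "avg m < avg (Suc m)" for m
    using a_pos[of "Suc m"] \<open>n \<ge> 1\<close> by (simp add: assms(10) divide_strict_right_mono)
  have r0: "r0 \<ge> 1" "?C r0" and least: "\<And>r. r \<ge> 1 \<Longrightarrow> ?C r \<Longrightarrow> r0 \<le> r"
    using LeastI_ex[of "\<lambda>r. r \<ge> 1 \<and> ?C r"] Least_le[of "\<lambda>r. r \<ge> 1 \<and> ?C r"] assms(11,12)
    by auto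
  have avg_le_S: "ereal (avg m) \<le> (?S + ereal \<alpha>) / ereal (real n)" for m
  proof -
    have "ereal (\<Sum>i=1..m. a i) = (\<Sum>i<m. ereal (a (Suc i)))"
      by (simp add: sum.atLeast1_atMost_eq lessThan_atLeast0)
    also have "\<dots> \<le> ?S"
      using a_pos by (intro suminf_upper) (simp add: less_imp_le)
    finally have "ereal (\<Sum>i=1..m. a i) + ereal \<alpha> \<le> ?S + ereal \<alpha>" by (rule add_right_mono)
    then have "(ereal (\<Sum>i=1..m. a i) + ereal \<alpha>) / ereal (real n) \<le> (?S + ereal \<alpha>) / ereal (real n)"
      using \<open>n \<ge> 1\<close> by (intro ereal_divide_right_mono) auto
    then show ?thesis using \<open>n \<ge> 1\<close> by (simp add: assms(10))
  qed
  have r0_small_imp: "\<exists>k\<in>{1..n-1}. r0 = enat k" if "r0 < enat n"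
    using that r0(1) by (cases r0) (auto simp: one_enat_def)
  have case1: "r0 < enat n \<longleftrightarrow> (\<exists>k\<in>{1..n-1}. c k = avg k)"
  proof
    assume "r0 < enat n"
    then show "\<exists>k\<in>{1..n-1}. c k = avg k" using r0_small_imp small r0(2) by metis
  next
    assume "\<exists>k\<in>{1..n-1}. c k = avg k"
    then obtain k where k: "k \<in> {1..n-1}" "c k = avg k" by blast
    then have "r0 \<le> enat k" using small by (intro least) (auto simp: one_enat_def)
    also have "enat k < enat n" using k by auto
    finally show "r0 < enat n" .
  qed
  have value1: "\<forall>k\<in>{1..n-1}. r0 = enat k \<longrightarrow> c k = avg k" using small r0(2) by blast
  have case2: "\<exists>m\<ge>1. r0 = enat m \<and> c n \<le> avg m \<and> (\<forall>j\<ge>1. c n \<le> avg j \<longrightarrow> m \<le> j)"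
    if ge: "enat n \<le> r0" and "r0 < \<infinity>"
  proof -
    obtain m where m: "r0 = enat m" using \<open>r0 < \<infinity>\<close> by (cases r0) auto
    have m1: "m \<ge> 1" "n \<le> m" using r0(1) ge m by (auto simp: one_enat_def)
    have "m \<le> j" if j: "j \<ge> 1" "c n \<le> avg j" for j
    proof -
      have "c (min n j) \<le> avg j" using c_mono[of "min n j"] j(2) by simp
      then have "r0 \<le> enat j" using fin[OF j(1)] j(1) by (intro least) (auto simp: one_enat_def)
      then show ?thesis by (simp add: m)
    qed
    moreover have "c n \<le> avg m" using fin[OF m1(1)] r0(2) m m1(2) by (simp add: min_def)
    ultimately show ?thesis using m m1(1) by blast
  qed
  have case3: "ereal (c n) = (?S + ereal \<alpha>) / ereal (real n)" if r: "r0 = \<infinity>"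
  proof -
    obtain s where s: "(\<lambda>i. a (Suc i)) sums s" and le: "c n \<le> (s + \<alpha>) / real n"
      using inf r0(2) r by auto
    have S: "?S = ereal s" using s by (metis sums_ereal sums_unique)
    \<comment> \<open>A strict inequality would hold for a finite partial sum as well, so that finitely many
        vectors would suffice.\<close>
    have "\<not> c n < (s + \<alpha>) / real n"
    proof
      assume "c n < (s + \<alpha>) / real n"
      moreover have "(\<lambda>m. ((\<Sum>i<m. a (Suc i)) + \<alpha>) / real n) \<longlonglongrightarrow> (s + \<alpha>) / real n"
        using s \<open>n \<ge> 1\<close> unfolding sums_def by (intro tendsto_intros) auto
      ultimately have "\<forall>\<^sub>F m in sequentially. c n < ((\<Sum>i<m. a (Suc i)) + \<alpha>) / real n"
        by (intro order_tendstoD(1))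
      then have "\<forall>\<^sub>F m in sequentially. c n < avg m"
        by (simp add: assms(10) sum.atLeast1_atMost_eq lessThan_atLeast0)
      then obtain N where N: "\<And>m. m \<ge> N \<Longrightarrow> c n < avg m"
        by (auto simp: eventually_sequentially)
      define m where "m = max n N"
      have "?C (enat m)" using fin[of m] N[of m] \<open>n \<ge> 1\<close> by (auto simp: m_def min_def)
      then have "r0 \<le> enat m" using \<open>n \<ge> 1\<close> by (intro least) (auto simp: m_def one_enat_def)
      then show False using r by simp
    qed
    then show ?thesis using le S \<open>n \<ge> 1\<close> by simp
  qed
  have case3': "r0 = \<infinity>"
    if "\<not> r0 < enat n" and eq: "ereal (c n) = (?S + ereal \<alpha>) / ereal (real n)"
  proof (rule ccontr)
    assume "r0 \<noteq> \<infinity>"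
    then have "enat n \<le> r0" "r0 < \<infinity>" using that(1) by auto
    from case2[OF this] obtain m where m: "r0 = enat m" "c n \<le> avg m" by blast
    \<comment> \<open>A finite \<open>r0\<close> would give \<open>c n \<le> avg m < avg (Suc m)\<close>, but \<open>c n\<close> is the limit of the
        strictly increasing averages.\<close>
    have "c n < avg (Suc m)" using m(2) avg_Suc[of m] by simp
    moreover have "avg (Suc m) \<le> c n" using avg_le_S[of "Suc m"] eq by (metis ereal_less_eq(3))
    ultimately show False by simp
  qed
  show ?thesis
  proof (intro conjI iffI)
    show "\<forall>k\<in>{1..n-1}. c k \<noteq> avg k" if "enat n \<le> r0 \<and> r0 < \<infinity>"
      using that case1 by (metis leD)
    show "\<forall>k\<in>{1..n-1}. c k \<noteq> avg k" if "r0 = \<infinity>"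
      using that case1 by auto
  next
    assume R: "(\<forall>k\<in>{1..n-1}. c k \<noteq> avg k) \<and>
      (\<exists>m\<ge>1. r0 = enat m \<and> c n \<le> avg m \<and> (\<forall>j\<ge>1. c n \<le> avg j \<longrightarrow> m \<le> j))"
    then show "enat n \<le> r0" using case1 by (meson not_le)
    show "r0 < \<infinity>" using R by auto
  qed (use case1 value1 case2 case3 case3' in auto)
qed

end
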